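(* Let $p$ be a prime, $1\le r\le q<\infty$ and $0\le\beta<1$. For every $\xi\in\mathbb{Q}_p^*$, the dilation operator $D_\xi$, defined by $(D_\xi f)(x)=f(\xi x)$ for $x\in\mathbb{Q}_p$, is bounded on $C^{\beta}M_{r,q}(\mathbb{Q}_p)$. Moreover, for every $f\in C^{\beta}M_{r,q}(\mathbb{Q}_p)$, $$\|D_\xi f\|_{C^{\beta}M_{r,q}(\mathbb{Q}_p)}=|\xi|_p^{-\beta-\frac1q}\,\|f\|_{C^{\beta}M_{r,q}(\mathbb{Q}_p)}.$$
   Context: $\mathbb{Q}_p$ is the field of $p$-adic numbers with the $p$-adic absolute value $|\cdot|_p$, $\mathbb{Q}_p^*=\mathbb{Q}_p\setminus\{0\}$, and $dx$ is the Haar measure on $(\mathbb{Q}_p,+)$ normalized so that $\{x:|x|_p\le 1\}$ has measure $1$; $|E|$ denotes the measure of $E$. For $a\in\mathbb{Q}_p$, $\ell\in\mathbb{Z}$, let $B^\ell(a)=\{x\in\mathbb{Q}_p:|x-a|_p\le p^\ell\}$, so $|B^\ell(a)|=p^\ell$. For $1\le r\le q<\infty$ and $0\le\beta<1$, the fractional Cesàro–Morrey space $C^{\beta}M_{r,q}(\mathbb{Q}_p)$ consists of all locally integrable functions $f$ on $\mathbb{Q}_p$ with $\|f\|_{C^{\beta}M_{r,q}(\mathbb{Q}_p)}<\infty$, where $$\|f\|_{C^{\beta}M_{r,q}(\mathbb{Q}_p)}=\sup_{a\in\mathbb{Q}_p,\ \ell\in\mathbb{Z}}|B^\ell(a)|^{\frac1q-\frac1r}\left(\int_{B^\ell(a)}\left(\frac{1}{|x|_p^{1-\beta}}\int_{|t|_p\le|x|_p}|f(t)|\,dt\right)^r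 dx\right)^{1/r}.$$ *)

theory Defs
  imports "HOL-Analysis.Analysis" "Berlekamp_Zassenhaus.Finite_Field"
begin

section \<open>The field of p-adic numbers\<close>

subsection \<open>The p-adic absolute value on the rationals\<close>

definition padic_abs_rat :: "nat \<Rightarrow> rat \<Rightarrow> real" where
  "padic_abs_rat p x =
     (if x = 0 then 0
      else let (a, b) = quotient_of x
           in real p powi (int (multiplicity (int p) b) - int (multiplicity (int p) a)))"

lemma padic_abs_rat_of_int_div:
  assumes p: "prime p" and a: "a \<noteq> 0" and b: "b \<noteq> 0"
  shows "padic_abs_rat p (of_int a / of_int b) =
    real p powi (int (multiplicity (int p) b) - int (multiplicity (int p) a))"
proof -
  define x :: rat where "x = of_int a / of_int b"
  obtain c d where cd: "quotient_of x = (c, d)" by force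
  have d: "d > 0" using quotient_of_denom_pos[OF cd] .
  have xcd: "x = of_int c / of_int d" using quotient_of_div[OF cd] .
  have x: "x \<noteq> 0" using a b by (simp add: x_def)
  then have c: "c \<noteq> 0" using xcd by auto
  have "(of_int a * of_int d :: rat) = of_int c * of_int b"
    using xcd b d by (simp add: x_def field_simps)
  then have eq: "a * d = c * b"
    by (metis of_int_eq_iff of_int_mult)
  have pp: "prime_elem (int p)" using p by simp
  have "multiplicity (int p) (a * d) = multiplicity (int p) a + multiplicity (int p) d"
    using pp a d by (intro prime_elem_multiplicity_mult_distrib) auto
  moreover have "multiplicity (int p) (c * b) = multiplicity (int p) c + multiplicity (int p) b"
    using pp b c by (intro prime_elem_multiplicity_mult_distrib) auto
  ultimately have "int (multiplicity (int p) d) - int (multiplicity (int p) c) =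
      int (multiplicity (int p) b) - int (multiplicity (int p) a)"
    using eq by simp
  then show ?thesis
    using x cd by (simp add: padic_abs_rat_def x_def)
qed

lemma padic_abs_rat_zero [simp]: "padic_abs_rat p 0 = 0"
  by (simp add: padic_abs_rat_def)

lemma padic_abs_rat_pos:
  assumes "prime p" "x \<noteq> 0"
  shows "padic_abs_rat p x > 0"
  using assms prime_gt_0_nat[of p]
  by (auto simp: padic_abs_rat_def split: prod.splits)

lemma padic_abs_rat_nonneg [simp]: "padic_abs_rat p x \<ge> 0"
  by (auto simp: padic_abs_rat_def split: prod.splits)

lemma padic_abs_rat_eq_0_iff: "prime p \<Longrightarrow> padic_abs_rat p x = 0 \<longleftrightarrow> x = 0"
  by (metis less_irrefl padic_abs_rat_pos padic_abs_rat_zero)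

lemma rat_cases_div:
  fixes x :: rat
  assumes "x \<noteq> 0"
  obtains a b where "x = of_int a / of_int b" "a \<noteq> 0" "b \<noteq> 0"
proof -
  obtain a b where ab: "quotient_of x = (a, b)" by force
  then have "x = of_int a / of_int b" "b > 0"
    using quotient_of_div[OF ab] quotient_of_denom_pos[OF ab] by auto
  with assms show thesis by (intro that[of a b]) auto
qed

lemma padic_abs_rat_mult:
  assumes p: "prime p"
  shows "padic_abs_rat p (x * y) = padic_abs_rat p x * padic_abs_rat p y"
proof (cases "x = 0 \<or> y = 0")
  case False
  then obtain a b c d where x: "x = of_int a / of_int b" "a \<noteq> 0" "b \<noteq> 0"
    and y: "y = of_int c / of_int d" "c \<noteq> 0" "d \<noteq> 0"
    by (metis rat_cases_div)
  have pp: "prime_elem (int p)" using p by simp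
  have p0: "real p \<noteq> 0" using prime_gt_0_nat[OF p] by simp
  have xy: "x * y = of_int (a * c) / of_int (b * d)" using x y by simp
  have "padic_abs_rat p (x * y) =
      real p powi (int (multiplicity (int p) (b * d)) - int (multiplicity (int p) (a * c)))"
    unfolding xy using x y by (intro padic_abs_rat_of_int_div[OF p]) auto
  also have "\<dots> = real p powi ((int (multiplicity (int p) b) - int (multiplicity (int p) a)) +
      (int (multiplicity (int p) d) - int (multiplicity (int p) c)))"
    using x y by (simp add: prime_elem_multiplicity_mult_distrib[OF pp] algebra_simps)
  also have "\<dots> = padic_abs_rat p x * padic_abs_rat p y"
    unfolding x(1) y(1) padic_abs_rat_of_int_div[OF p x(2,3)] padic_abs_rat_of_int_div[OF p y(2,3)]
    using p0 by (subst power_int_add) auto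
  finally show ?thesis .
qed auto

lemma padic_abs_rat_one [simp]: "prime p \<Longrightarrow> padic_abs_rat p 1 = 1"
  by (simp add: padic_abs_rat_def)

lemma padic_abs_rat_minus [simp]: "padic_abs_rat p (- x) = padic_abs_rat p x"
  by (auto simp: padic_abs_rat_def rat_uminus_code multiplicity_def split: prod.splits)

lemma padic_abs_rat_inverse:
  assumes "prime p"
  shows "padic_abs_rat p (inverse x) = inverse (padic_abs_rat p x)"
proof (cases "x = 0")
  case False
  then have "padic_abs_rat p x * padic_abs_rat p (inverse x) = 1"
    using assms by (simp flip: padic_abs_rat_mult)
  then show ?thesis by (metis inverse_unique)
qed simp

lemma padic_abs_rat_add_le_max:
  assumes p: "prime p"
  shows "padic_abs_rat p (x + y) \<le> max (padic_abs_rat p x) (padic_abs_rat p y)"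
proof (cases "x = 0 \<or> y = 0 \<or> x + y = 0")
  case True
  then show ?thesis by (auto simp: max_def)
next
  case False
  then obtain a b c d where x: "x = of_int a / of_int b" "a \<noteq> 0" "b \<noteq> 0"
    and y: "y = of_int c / of_int d" "c \<noteq> 0" "d \<noteq> 0"
    by (metis rat_cases_div)
  have p1: "real p \<ge> 1" using prime_ge_1_nat[OF p] by simp
  have p2: "\<not> is_unit (int p)" using prime_gt_1_nat[OF p] by simp
  have x': "x = of_int (a * d) / of_int (b * d)" and y': "y = of_int (c * b) / of_int (b * d)"
    using x y by simp_all
  have xy: "x + y = of_int (a * d + c * b) / of_int (b * d)"
    using x y by (simp add: field_simps)
  have nz: "a * d + c * b \<noteq> 0" using False xy by (metis div_0 of_int_0)
  define m where "m = min (multiplicity (int p) (a * d)) (multiplicity (int p) (c * b))"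
  have "int p ^ m dvd a * d" "int p ^ m dvd c * b"
    by (auto simp: m_def intro: multiplicity_dvd')
  then have "int p ^ m dvd a * d + c * b" by simp
  then have m: "m \<le> multiplicity (int p) (a * d + c * b)"
    using nz p2 by (intro multiplicity_geI) auto
  have "padic_abs_rat p (x + y) =
      real p powi (int (multiplicity (int p) (b * d)) - int (multiplicity (int p) (a * d + c * b)))"
    unfolding xy using x y nz by (intro padic_abs_rat_of_int_div[OF p]) auto
  also have "\<dots> \<le> real p powi (int (multiplicity (int p) (b * d)) - int m)"
    using m p1 by (intro power_int_increasing) auto
  also have "\<dots> \<le> max (padic_abs_rat p x) (padic_abs_rat p y)"
  proof (cases "multiplicity (int p) (a * d) \<le> multiplicity (int p) (c * b)")
    case True
    then have "padic_abs_rat p x = real p powi (int (multiplicity (int p) (b * d)) - int m)"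
      unfolding x' m_def using x y by (subst padic_abs_rat_of_int_div[OF p]) auto
    then show ?thesis by simp
  next
    case False
    then have "padic_abs_rat p y = real p powi (int (multiplicity (int p) (b * d)) - int m)"
      unfolding y' m_def using x y by (subst padic_abs_rat_of_int_div[OF p]) auto
    then show ?thesis by simp
  qed
  finally show ?thesis .
qed

lemma padic_abs_rat_triangle:
  assumes "prime p"
  shows "padic_abs_rat p (x + y) \<le> padic_abs_rat p x + padic_abs_rat p y"
  using padic_abs_rat_add_le_max[OF assms, of x y]
    padic_abs_rat_nonneg[of p x] padic_abs_rat_nonneg[of p y] by linarith

lemma padic_abs_rat_diff_triangle:
  assumes "prime p"
  shows "\<bar>padic_abs_rat p x - padic_abs_rat p y\<bar> \<le> padic_abs_rat p (x - y)"
  using padic_abs_rat_triangle[OF assms, of "x - y" y]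
    padic_abs_rat_triangle[OF assms, of "y - x" x] padic_abs_rat_minus[of p "x - y"]
  by simp


subsection \<open>Cauchy sequences of rationals\<close>

definition padic_cauchy :: "nat \<Rightarrow> (nat \<Rightarrow> rat) \<Rightarrow> bool" where
  "padic_cauchy p X \<longleftrightarrow> (\<forall>e>0. \<exists>k. \<forall>m\<ge>k. \<forall>n\<ge>k. padic_abs_rat p (X m - X n) < e)"

definition padic_vanishes :: "nat \<Rightarrow> (nat \<Rightarrow> rat) \<Rightarrow> bool" where
  "padic_vanishes p X \<longleftrightarrow> (\<lambda>n. padic_abs_rat p (X n)) \<longlonglongrightarrow> 0"

lemma padic_cauchy_const: "padic_cauchy p (\<lambda>n. c)"
  by (simp add: padic_cauchy_def)

lemma padic_vanishes_zero: "padic_vanishes p (\<lambda>n. 0)"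
  by (simp add: padic_vanishes_def)

lemma padic_cauchy_minus: "padic_cauchy p X \<Longrightarrow> padic_cauchy p (\<lambda>n. - X n)"
  unfolding padic_cauchy_def by (metis minus_diff_minus padic_abs_rat_minus)

lemma padic_cauchy_add:
  assumes p: "prime p" and X: "padic_cauchy p X" and Y: "padic_cauchy p Y"
  shows "padic_cauchy p (\<lambda>n. X n + Y n)"
  unfolding padic_cauchy_def
proof (intro allI impI)
  fix e :: real assume e: "e > 0"
  obtain i where i: "\<forall>m\<ge>i. \<forall>n\<ge>i. padic_abs_rat p (X m - X n) < e"
    using X e unfolding padic_cauchy_def by blast
  obtain j where j: "\<forall>m\<ge>j. \<forall>n\<ge>j. padic_abs_rat p (Y m - Y n) < e"
    using Y e unfolding padic_cauchy_def by blast
  have "padic_abs_rat p (X m + Y m - (X n + Y n)) < e" if "m \<ge> max i j" "n \<ge> max i j" for m n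
  proof -
    have "padic_abs_rat p ((X m - X n) + (Y m - Y n)) < e"
      using padic_abs_rat_add_le_max[OF p, of "X m - X n" "Y m - Y n"] i j that
      by (intro le_less_trans[OF padic_abs_rat_add_le_max[OF p]]) auto
    then show ?thesis by (simp add: algebra_simps)
  qed
  then show "\<exists>k. \<forall>m\<ge>k. \<forall>n\<ge>k. padic_abs_rat p (X m + Y m - (X n + Y n)) < e"
    by blast
qed

lemma padic_cauchy_diff:
  assumes p: "prime p" and X: "padic_cauchy p X" and Y: "padic_cauchy p Y"
  shows "padic_cauchy p (\<lambda>n. X n - Y n)"
  using padic_cauchy_add[OF p X padic_cauchy_minus[OF Y]] by simp

lemma padic_cauchy_abs_convergent:
  assumes p: "prime p" and X: "padic_cauchy p X"
  shows "convergent (\<lambda>n. padic_abs_rat p (X n))"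
proof -
  have "Cauchy (\<lambda>n. padic_abs_rat p (X n))"
  proof (rule metric_CauchyI)
    fix e :: real assume "e > 0"
    then obtain k where "\<forall>m\<ge>k. \<forall>n\<ge>k. padic_abs_rat p (X m - X n) < e"
      using X unfolding padic_cauchy_def by blast
    then have "\<forall>m\<ge>k. \<forall>n\<ge>k. dist (padic_abs_rat p (X m)) (padic_abs_rat p (X n)) < e"
      by (auto simp: dist_real_def intro: le_less_trans[OF padic_abs_rat_diff_triangle[OF p]])
    then show "\<exists>k. \<forall>m\<ge>k. \<forall>n\<ge>k. dist (padic_abs_rat p (X m)) (padic_abs_rat p (X n)) < e" ..
  qed
  then show ?thesis by (rule real_Cauchy_convergent)
qed

lemma padic_cauchy_abs_tendsto:
  assumes "prime p" "padic_cauchy p X"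
  shows "(\<lambda>n. padic_abs_rat p (X n)) \<longlonglongrightarrow> lim (\<lambda>n. padic_abs_rat p (X n))"
  using padic_cauchy_abs_convergent[OF assms] by (rule convergent_LIMSEQ_iff[THEN iffD1])

lemma padic_vanishes_iff_lim:
  assumes "prime p" "padic_cauchy p X"
  shows "padic_vanishes p X \<longleftrightarrow> lim (\<lambda>n. padic_abs_rat p (X n)) = 0"
  using padic_cauchy_abs_tendsto[OF assms] limI[of "\<lambda>n. padic_abs_rat p (X n)" 0]
  unfolding padic_vanishes_def by metis

lemma padic_cauchy_bounded:
  assumes "prime p" "padic_cauchy p X"
  obtains B where "B > 0" "\<And>n. padic_abs_rat p (X n) \<le> B"
proof -
  have "Bseq (\<lambda>n. padic_abs_rat p (X n))"
    using padic_cauchy_abs_convergent[OF assms] by (rule convergent_imp_Bseq)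
  then obtain B where "B > 0" "\<And>n. norm (padic_abs_rat p (X n)) \<le> B"
    by (rule BseqE) blast
  then show thesis by (intro that[of B]) auto
qed

lemma padic_cauchy_mult:
  assumes p: "prime p" and X: "padic_cauchy p X" and Y: "padic_cauchy p Y"
  shows "padic_cauchy p (\<lambda>n. X n * Y n)"
  unfolding padic_cauchy_def
proof (intro allI impI)
  fix e :: real assume e: "e > 0"
  obtain A where A: "A > 0" "\<And>n. padic_abs_rat p (X n) \<le> A" using padic_cauchy_bounded[OF p X] by blast
  obtain B where B: "B > 0" "\<And>n. padic_abs_rat p (Y n) \<le> B" using padic_cauchy_bounded[OF p Y] by blast
  have "e / (2 * B) > 0" "e / (2 * A) > 0" using e A B by auto
  then obtain i j where i: "\<forall>m\<ge>i. \<forall>n\<ge>i. padic_abs_rat p (X m - X n) < e / (2 * B)"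
    and j: "\<forall>m\<ge>j. \<forall>n\<ge>j. padic_abs_rat p (Y m - Y n) < e / (2 * A)"
    using X Y unfolding padic_cauchy_def by metis
  have "padic_abs_rat p (X m * Y m - X n * Y n) < e" if mn: "m \<ge> max i j" "n \<ge> max i j" for m n
  proof -
    have "padic_abs_rat p (X m * Y m - X n * Y n) \<le>
        padic_abs_rat p (X m) * padic_abs_rat p (Y m - Y n) +
        padic_abs_rat p (X m - X n) * padic_abs_rat p (Y n)"
      using padic_abs_rat_triangle[OF p, of "X m * (Y m - Y n)" "(X m - X n) * Y n"]
      by (simp add: mult_diff_mult padic_abs_rat_mult[OF p])
    also have "\<dots> \<le> A * padic_abs_rat p (Y m - Y n) + padic_abs_rat p (X m - X n) * B"
      using A B by (intro add_mono mult_mono) auto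
    also have "\<dots> < A * (e / (2 * A)) + (e / (2 * B)) * B"
      using A B i j mn by (intro add_strict_mono mult_strict_left_mono mult_strict_right_mono) auto
    also have "\<dots> = e" using A B by simp
    finally show ?thesis .
  qed
  then show "\<exists>k. \<forall>m\<ge>k. \<forall>n\<ge>k. padic_abs_rat p (X m * Y m - X n * Y n) < e"
    by blast
qed

lemma padic_not_vanishes:
  assumes p: "prime p" and X: "padic_cauchy p X" and nz: "\<not> padic_vanishes p X"
  obtains b k where "b > 0" "\<And>n. n \<ge> k \<Longrightarrow> padic_abs_rat p (X n) > b"
proof -
  define L where "L = lim (\<lambda>n. padic_abs_rat p (X n))"
  have L: "(\<lambda>n. padic_abs_rat p (X n)) \<longlonglongrightarrow> L"
    unfolding L_def by (rule padic_cauchy_abs_tendsto[OF p X])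
  have "L \<noteq> 0" using nz padic_vanishes_iff_lim[OF p X] L_def by simp
  moreover have "L \<ge> 0" by (rule LIMSEQ_le_const[OF L]) auto
  ultimately have L0: "L > 0" by simp
  then have "eventually (\<lambda>n. padic_abs_rat p (X n) > L / 2) sequentially"
    by (intro order_tendstoD(1)[OF L]) simp
  then show thesis using that[of "L / 2"] L0 by (auto simp: eventually_sequentially)
qed

lemma padic_cauchy_inverse:
  assumes p: "prime p" and X: "padic_cauchy p X" and nz: "\<not> padic_vanishes p X"
  shows "padic_cauchy p (\<lambda>n. inverse (X n))"
  unfolding padic_cauchy_def
proof (intro allI impI)
  fix e :: real assume e: "e > 0"
  obtain b k where b: "b > 0" "\<And>n. n \<ge> k \<Longrightarrow> padic_abs_rat p (X n) > b"
    using padic_not_vanishes[OF assms] by blast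
  have "e * b * b > 0" using e b by simp
  then obtain i where i: "\<forall>m\<ge>i. \<forall>n\<ge>i. padic_abs_rat p (X m - X n) < e * b * b"
    using X unfolding padic_cauchy_def by blast
  have "padic_abs_rat p (inverse (X m) - inverse (X n)) < e"
    if mn: "m \<ge> max i k" "n \<ge> max i k" for m n
  proof -
    have bm: "padic_abs_rat p (X m) > b" "padic_abs_rat p (X n) > b" using b mn by auto
    then have nz: "X m \<noteq> 0" "X n \<noteq> 0" using b(1) by auto
    have "padic_abs_rat p (inverse (X m) - inverse (X n)) =
       padic_abs_rat p (X m - X n) / (padic_abs_rat p (X m) * padic_abs_rat p (X n))"
      by (simp only: inverse_diff_inverse[OF nz] padic_abs_rat_minus padic_abs_rat_mult[OF p]
          padic_abs_rat_inverse[OF p] divide_inverse inverse_mult_distrib ac_simps)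
    also have "\<dots> \<le> padic_abs_rat p (X m - X n) / (b * b)"
      using b bm by (intro divide_left_mono mult_mono) auto
    also have "\<dots> < (e * b * b) / (b * b)"
      using i mn b by (intro divide_strict_right_mono) auto
    also have "\<dots> = e" using b by simp
    finally show ?thesis .
  qed
  then show "\<exists>k. \<forall>m\<ge>k. \<forall>n\<ge>k. padic_abs_rat p (inverse (X m) - inverse (X n)) < e"
    by blast
qed

lemma padic_vanishes_minus: "padic_vanishes p X \<Longrightarrow> padic_vanishes p (\<lambda>n. - X n)"
  by (simp add: padic_vanishes_def)

lemma padic_vanishes_add:
  assumes p: "prime p" and "padic_vanishes p X" "padic_vanishes p Y"
  shows "padic_vanishes p (\<lambda>n. X n + Y n)"
proof -
  have lim: "(\<lambda>n. padic_abs_rat p (X n) + padic_abs_rat p (Y n)) \<longlonglongrightarrow> 0"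
    using tendsto_add[OF assms(2,3)[unfolded padic_vanishes_def]] by simp
  show ?thesis
    unfolding padic_vanishes_def
    by (rule tendsto_sandwich[OF _ _ tendsto_const lim])
       (auto intro!: always_eventually padic_abs_rat_triangle[OF p])
qed

lemma padic_vanishes_mult:
  assumes p: "prime p" and X: "padic_cauchy p X" and Y: "padic_vanishes p Y"
  shows "padic_vanishes p (\<lambda>n. X n * Y n)"
  using tendsto_mult[OF padic_cauchy_abs_tendsto[OF p X] Y[unfolded padic_vanishes_def]]
  by (simp add: padic_vanishes_def padic_abs_rat_mult[OF p])

text \<open>The ring of \<open>p\<close>-adic Cauchy sequences of rationals, where \<open>p\<close> is the cardinality of the
  index type.\<close>

typedef (overloaded) 'p padic_seq = "{X. padic_cauchy CARD('p::prime_card) X}"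
  using padic_cauchy_const by blast

setup_lifting type_definition_padic_seq

instantiation padic_seq :: (prime_card) comm_ring_1
begin

lift_definition zero_padic_seq :: "'a padic_seq" is "\<lambda>n. 0" by (rule padic_cauchy_const)
lift_definition one_padic_seq :: "'a padic_seq" is "\<lambda>n. 1" by (rule padic_cauchy_const)
lift_definition plus_padic_seq :: "'a padic_seq \<Rightarrow> 'a padic_seq \<Rightarrow> 'a padic_seq"
  is "\<lambda>X Y n. X n + Y n" by (rule padic_cauchy_add[OF prime_card])
lift_definition uminus_padic_seq :: "'a padic_seq \<Rightarrow> 'a padic_seq"
  is "\<lambda>X n. - X n" by (rule padic_cauchy_minus)
lift_definition minus_padic_seq :: "'a padic_seq \<Rightarrow> 'a padic_seq \<Rightarrow> 'a padic_seq"
  is "\<lambda>X Y n. X n - Y n" by (rule padic_cauchy_diff[OF prime_card])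
lift_definition times_padic_seq :: "'a padic_seq \<Rightarrow> 'a padic_seq \<Rightarrow> 'a padic_seq"
  is "\<lambda>X Y n. X n * Y n" by (rule padic_cauchy_mult[OF prime_card])

instance
  by standard (transfer; auto simp: fun_eq_iff algebra_simps)+

end

lift_definition null_padic_seq :: "'p::prime_card padic_seq \<Rightarrow> bool"
  is "\<lambda>X. padic_vanishes CARD('p) X" .

lift_definition inverse_padic_seq :: "'p::prime_card padic_seq \<Rightarrow> 'p padic_seq"
  is "\<lambda>X. if padic_vanishes CARD('p) X then (\<lambda>n. 0) else (\<lambda>n. inverse (X n))"
  by (auto intro: padic_cauchy_const padic_cauchy_inverse[OF prime_card])

lift_definition abs_padic_seq :: "'p::prime_card padic_seq \<Rightarrow> real"
  is "\<lambda>X. lim (\<lambda>n. padic_abs_rat CARD('p) (X n))" .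

lemma null_padic_seq_zero: "null_padic_seq 0"
  by transfer (rule padic_vanishes_zero)

lemma null_padic_seq_minus: "null_padic_seq X \<Longrightarrow> null_padic_seq (- X)"
  by transfer (rule padic_vanishes_minus)

lemma null_padic_seq_add: "null_padic_seq X \<Longrightarrow> null_padic_seq Y \<Longrightarrow> null_padic_seq (X + Y)"
  by transfer (rule padic_vanishes_add[OF prime_card])

lemma null_padic_seq_mult: "null_padic_seq Y \<Longrightarrow> null_padic_seq (X * Y)"
  by transfer (rule padic_vanishes_mult[OF prime_card])

lemma null_padic_seq_iff_abs: "null_padic_seq X \<longleftrightarrow> abs_padic_seq X = 0"
  by transfer (rule padic_vanishes_iff_lim[OF prime_card])

lemma abs_padic_seq_tendsto:
  "(\<lambda>n. padic_abs_rat CARD('p::prime_card) (Rep_padic_seq X n)) \<longlonglongrightarrow> abs_padic_seq (X :: 'p padic_seq)"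
  by transfer (rule padic_cauchy_abs_tendsto[OF prime_card])

lemma abs_padic_seq_minus [simp]: "abs_padic_seq (- X) = abs_padic_seq X"
  by transfer simp

lemma abs_padic_seq_triangle:
  fixes X Y :: "'p::prime_card padic_seq"
  shows "abs_padic_seq (X + Y) \<le> abs_padic_seq X + abs_padic_seq Y"
  by (rule LIMSEQ_le[OF abs_padic_seq_tendsto tendsto_add[OF abs_padic_seq_tendsto abs_padic_seq_tendsto]])
     (simp add: plus_padic_seq.rep_eq padic_abs_rat_triangle[OF prime_card])

lemma abs_padic_seq_cong:
  fixes X Y :: "'p::prime_card padic_seq"
  assumes "null_padic_seq (X - Y)"
  shows "abs_padic_seq X = abs_padic_seq Y"
  using abs_padic_seq_triangle[of "X - Y" Y] abs_padic_seq_triangle[of "- (X - Y)" X] assms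
  by (simp add: null_padic_seq_iff_abs abs_padic_seq_minus del: minus_diff_eq)

lemma inverse_padic_seq_mult:
  fixes X :: "'p::prime_card padic_seq"
  assumes "\<not> null_padic_seq X"
  shows "null_padic_seq (inverse_padic_seq X * X - 1)"
  using assms
proof transfer
  fix X assume X: "padic_cauchy CARD('p) X" and nz: "\<not> padic_vanishes CARD('p) X"
  obtain b k where b: "b > 0" "\<And>n. n \<ge> k \<Longrightarrow> padic_abs_rat CARD('p) (X n) > b"
    using padic_not_vanishes[OF prime_card X nz] by blast
  have "X n \<noteq> 0" if "n \<ge> k" for n using b(2)[OF that] b(1) by auto
  then have "eventually (\<lambda>n. padic_abs_rat CARD('p) (inverse (X n) * X n - 1) = 0) sequentially"
    by (intro eventually_sequentiallyI[of k]) simp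
  then have "padic_vanishes CARD('p) (\<lambda>n. inverse (X n) * X n - 1)"
    unfolding padic_vanishes_def by (rule tendsto_eventually)
  then show "padic_vanishes CARD('p)
      (\<lambda>n. (if padic_vanishes CARD('p) X then \<lambda>n. 0 else (\<lambda>n. inverse (X n))) n * X n - 1)"
    using nz by simp
qed

lemma null_padic_seq_one: "\<not> null_padic_seq (1 :: 'p::prime_card padic_seq)"
  by transfer (simp add: padic_vanishes_def prime_card LIMSEQ_const_iff)

lemma null_inverse_padic_seq: "null_padic_seq X \<Longrightarrow> inverse_padic_seq X = 0"
  by transfer simp


subsection \<open>The field \<open>\<rat>\<^sub>p\<close>\<close>

text \<open>The type \<open>'p padic\<close> is the completion of \<open>\<rat>\<close> with respect to the \<open>p\<close>-adic absolute value,
  where \<open>p = CARD('p)\<close>: Cauchy sequences modulo null sequences.\<close>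

definition padic_rel :: "'p::prime_card padic_seq \<Rightarrow> 'p padic_seq \<Rightarrow> bool" where
  "padic_rel X Y \<longleftrightarrow> null_padic_seq (X - Y)"

lemma padic_rel_refl: "padic_rel X X"
  by (simp add: padic_rel_def null_padic_seq_zero)

lemma padic_rel_sym: "padic_rel X Y \<Longrightarrow> padic_rel Y X"
  using null_padic_seq_minus[of "X - Y"] by (simp add: padic_rel_def)

lemma padic_rel_trans: "padic_rel X Y \<Longrightarrow> padic_rel Y Z \<Longrightarrow> padic_rel X Z"
  using null_padic_seq_add[of "X - Y" "Y - Z"] by (simp add: padic_rel_def)

quotient_type (overloaded) 'p padic = "'p::prime_card padic_seq" / padic_rel
  by (intro equivpI reflpI sympI transpI padic_rel_refl)
     (auto intro: padic_rel_sym padic_rel_trans)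

instantiation padic :: (prime_card) field
begin

lift_definition zero_padic :: "'a padic" is 0 .

lift_definition one_padic :: "'a padic" is 1 .

lift_definition plus_padic :: "'a padic \<Rightarrow> 'a padic \<Rightarrow> 'a padic" is "(+)"
  unfolding padic_rel_def add_diff_add by (rule null_padic_seq_add)

lift_definition uminus_padic :: "'a padic \<Rightarrow> 'a padic" is uminus
  unfolding padic_rel_def minus_diff_minus by (rule null_padic_seq_minus)

lift_definition minus_padic :: "'a padic \<Rightarrow> 'a padic \<Rightarrow> 'a padic" is "(-)"
proof -
  fix A B C D :: "'a padic_seq"
  assume "padic_rel A B" "padic_rel C D"
  then have "null_padic_seq ((A - B) + - (C - D))"
    unfolding padic_rel_def by (intro null_padic_seq_add null_padic_seq_minus)
  then show "padic_rel (A - C) (B - D)"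
    by (simp add: padic_rel_def algebra_simps)
qed

lift_definition times_padic :: "'a padic \<Rightarrow> 'a padic \<Rightarrow> 'a padic" is "(*)"
proof -
  fix A B C D :: "'a padic_seq"
  assume "padic_rel A B" "padic_rel C D"
  then have "null_padic_seq (A * (C - D) + D * (A - B))"
    unfolding padic_rel_def by (intro null_padic_seq_add null_padic_seq_mult)
  then show "padic_rel (A * C) (B * D)"
    by (simp add: padic_rel_def algebra_simps)
qed

lift_definition inverse_padic :: "'a padic \<Rightarrow> 'a padic" is inverse_padic_seq
proof -
  fix X Y :: "'a padic_seq"
  assume XY: "padic_rel X Y"
  show "padic_rel (inverse_padic_seq X) (inverse_padic_seq Y)"
  proof (cases "null_padic_seq X")
    case True
    then have "null_padic_seq Y"
      using XY abs_padic_seq_cong[of X Y] by (simp add: padic_rel_def null_padic_seq_iff_abs)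
    with True show ?thesis by (simp add: null_inverse_padic_seq padic_rel_refl)
  next
    case False
    then have Y: "\<not> null_padic_seq Y"
      using XY abs_padic_seq_cong[of X Y] by (simp add: padic_rel_def null_padic_seq_iff_abs)
    let ?x = "inverse_padic_seq X" and ?y = "inverse_padic_seq Y"
    have "null_padic_seq (?y * (?x * X - 1) + - (?x * (?y * Y - 1)) + - (?x * ?y * (X - Y)))"
      using XY inverse_padic_seq_mult[OF False] inverse_padic_seq_mult[OF Y]
      by (intro null_padic_seq_add null_padic_seq_minus null_padic_seq_mult)
         (auto simp: padic_rel_def)
    then show ?thesis by (simp add: padic_rel_def algebra_simps)
  qed
qed

definition divide_padic :: "'a padic \<Rightarrow> 'a padic \<Rightarrow> 'a padic" where
  "divide_padic x y = x * inverse y"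

instance
proof
  fix a b c :: "'a padic"
  show "a + b + c = a + (b + c)" by transfer (simp add: algebra_simps padic_rel_refl)
  show "a + b = b + a" by transfer (simp add: algebra_simps padic_rel_refl)
  show "0 + a = a" by transfer (simp add: padic_rel_refl)
  show "- a + a = 0" by transfer (simp add: padic_rel_refl)
  show "a - b = a + - b" by transfer (simp add: padic_rel_refl)
  show "a * b * c = a * (b * c)" by transfer (simp add: algebra_simps padic_rel_refl)
  show "a * b = b * a" by transfer (simp add: algebra_simps padic_rel_refl)
  show "1 * a = a" by transfer (simp add: padic_rel_refl)
  show "(a + b) * c = a * c + b * c" by transfer (simp add: algebra_simps padic_rel_refl)
  show "(0::'a padic) \<noteq> 1"
  proof transfer
    show "\<not> padic_rel (0 :: 'a padic_seq) 1"
      using null_padic_seq_one padic_rel_sym[of "0 :: 'a padic_seq" 1] by (auto simp: padic_rel_def)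
  qed
  show "a \<noteq> 0 \<Longrightarrow> inverse a * a = 1"
    by transfer (simp add: padic_rel_def inverse_padic_seq_mult)
  show "a div b = a * inverse b" by (simp add: divide_padic_def)
  show "inverse (0::'a padic) = 0"
    by transfer (simp add: null_inverse_padic_seq null_padic_seq_zero padic_rel_refl)
qed

end

lift_definition padic_norm :: "'p::prime_card padic \<Rightarrow> real" is abs_padic_seq
  unfolding padic_rel_def by (rule abs_padic_seq_cong)

lemma padic_norm_eq_0_iff: "padic_norm x = 0 \<longleftrightarrow> x = 0"
  by transfer (simp add: padic_rel_def null_padic_seq_iff_abs)

lemma padic_norm_minus: "padic_norm (- x) = padic_norm x"
  by transfer simp

lemma padic_norm_triangle: "padic_norm (x + y) \<le> padic_norm x + padic_norm y"
  by transfer (rule abs_padic_seq_triangle)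

instantiation padic :: (prime_card) metric_space
begin

definition dist_padic :: "'a padic \<Rightarrow> 'a padic \<Rightarrow> real" where
  "dist_padic x y = padic_norm (x - y)"

definition uniformity_padic :: "('a padic \<times> 'a padic) filter" where
  "uniformity_padic = (INF e\<in>{0<..}. principal {(x, y). dist x y < e})"

definition open_padic :: "'a padic set \<Rightarrow> bool" where
  "open_padic U \<longleftrightarrow> (\<forall>x\<in>U. eventually (\<lambda>(x', y). x' = x \<longrightarrow> y \<in> U) uniformity)"

instance
proof
  fix x y z :: "'a padic"
  show "uniformity = (INF e\<in>{0<..}. principal {(x, y :: 'a padic). dist x y < e})"
    by (rule uniformity_padic_def)
  show "open U \<longleftrightarrow> (\<forall>x\<in>U. eventually (\<lambda>(x', y). x' = x \<longrightarrow> y \<in> U) uniformity)"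
    for U :: "'a padic set"
    by (rule open_padic_def)
  show "dist x y = 0 \<longleftrightarrow> x = y" by (simp add: dist_padic_def padic_norm_eq_0_iff)
  show "dist x y \<le> dist x z + dist y z"
    using padic_norm_triangle[of "x - z" "- (y - z)"] padic_norm_minus[of "y - z"]
    by (simp add: dist_padic_def del: minus_diff_eq)
qed

end


section \<open>Haar measure\<close>

text \<open>On \<open>\<rat>\<^sub>p\<close>, which is locally compact and second countable, regularity is a consequence of
  local finiteness and need not be required.\<close>

definition haar_measure :: "'a::{topological_space, ab_group_add} measure \<Rightarrow> bool" where
  "haar_measure \<mu> \<longleftrightarrow>
     sets \<mu> = sets borel \<and>
     (\<forall>a. \<forall>E\<in>sets borel. emeasure \<mu> ((\<lambda>x. a + x) ` E) = emeasure \<mu> E) \<and>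
     (\<forall>K. compact K \<longrightarrow> emeasure \<mu> K < \<infinity>) \<and>
     (\<forall>U. open U \<and> U \<noteq> {} \<longrightarrow> emeasure \<mu> U > 0)"

definition normalized_haar_measure :: "'p::prime_card padic measure \<Rightarrow> bool" where
  "normalized_haar_measure \<mu> \<longleftrightarrow> haar_measure \<mu> \<and> emeasure \<mu> {x. padic_norm x \<le> 1} = 1"


section \<open>Fractional Cesaro-Morrey spaces\<close>

definition padic_ball :: "'p::prime_card padic \<Rightarrow> int \<Rightarrow> 'p padic set" where
  "padic_ball a l = {x. padic_norm (x - a) \<le> real CARD('p) powi l}"

text \<open>Here and below functions are measurable with respect to, and integrated against, the completion
  of the Borel measure \<open>\<mu>\<close>.\<close>

definition locally_integrable :: "'p::prime_card padic measure \<Rightarrow> ('p padic \<Rightarrow> complex) \<Rightarrow> bool" where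
  "locally_integrable \<mu> f \<longleftrightarrow> (\<forall>K. compact K \<longrightarrow> set_integrable (completion \<mu>) K f)"

text \<open>The value at \<open>x = 0\<close> is \<open>0\<close> by the convention \<open>1 / 0 = 0\<close>; the point \<open>0\<close> has measure zero.
  The inner integral is meaningful for locally integrable \<open>f\<close> only.\<close>

definition fractional_cesaro ::
    "'p::prime_card padic measure \<Rightarrow> real \<Rightarrow> ('p padic \<Rightarrow> complex) \<Rightarrow> 'p padic \<Rightarrow> real" where
  "fractional_cesaro \<mu> \<beta> f x =
     1 / padic_norm x powr (1 - \<beta>) *
       (LINT t:{t. padic_norm t \<le> padic_norm x}|completion \<mu>. norm (f t))"

text \<open>The power \<open>x\<^sup>s\<close> for \<open>x \<in> [0, \<infinity>]\<close> and \<open>s > 0\<close>.\<close>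

definition ennreal_power :: "ennreal \<Rightarrow> real \<Rightarrow> ennreal" where
  "ennreal_power x s = (if x = \<infinity> then \<infinity> else ennreal (enn2real x powr s))"

definition cesaro_morrey_norm ::
    "'p::prime_card padic measure \<Rightarrow> real \<Rightarrow> real \<Rightarrow> real \<Rightarrow> ('p padic \<Rightarrow> complex) \<Rightarrow> ennreal" where
  "cesaro_morrey_norm \<mu> \<beta> r q f =
     (SUP a. SUP l.
        ennreal (measure \<mu> (padic_ball a l) powr (1 / q - 1 / r)) *
        ennreal_power
          (\<integral>\<^sup>+x\<in>padic_ball a l. ennreal (fractional_cesaro \<mu> \<beta> f x powr r) \<partial>completion \<mu>)
          (1 / r))"

definition cesaro_morrey_space ::
    "'p::prime_card padic measure \<Rightarrow> real \<Rightarrow> real \<Rightarrow> real \<Rightarrow> ('p padic \<Rightarrow> complex) set" where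
  "cesaro_morrey_space \<mu> \<beta> r q =
     {f. locally_integrable \<mu> f \<and> cesaro_morrey_norm \<mu> \<beta> r q f < \<infinity>}"

definition bounded_on_cesaro_morrey ::
    "'p::prime_card padic measure \<Rightarrow> real \<Rightarrow> real \<Rightarrow> real \<Rightarrow>
     (('p padic \<Rightarrow> complex) \<Rightarrow> 'p padic \<Rightarrow> complex) \<Rightarrow> bool" where
  "bounded_on_cesaro_morrey \<mu> \<beta> r q T \<longleftrightarrow>
     (\<forall>f\<in>cesaro_morrey_space \<mu> \<beta> r q. T f \<in> cesaro_morrey_space \<mu> \<beta> r q) \<and>
     (\<exists>C\<ge>0. \<forall>f\<in>cesaro_morrey_space \<mu> \<beta> r q.
        cesaro_morrey_norm \<mu> \<beta> r q (T f) \<le> ennreal C * cesaro_morrey_norm \<mu> \<beta> r q f)"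

definition dilation :: "'p::prime_card padic \<Rightarrow> ('p padic \<Rightarrow> complex) \<Rightarrow> 'p padic \<Rightarrow> complex" where
  "dilation \<xi> f = (\<lambda>x. f (\<xi> * x))"

end

theory Submission
  imports Defs
begin

text \<open>Everything rests on one fact about Haar measure: multiplication by \<open>\<xi>\<close> multiplies volumes by
  \<open>\<bar>\<xi>\<bar>\<close>. Granted this, substitution shows two things. The inner average satisfies
  \<open>C (D f) (x) = \<bar>\<xi>\<bar>\<^bsup>- \<beta>\<^esup> \<cdot> C f (\<xi> x)\<close>: the inner integral contributes \<open>\<bar>\<xi>\<bar>\<^bsup>- 1\<^esup>\<close> and the weight
  \<open>\<bar>x\<bar>\<^bsup>\<beta> - 1\<^esup>\<close> contributes \<open>\<bar>\<xi>\<bar>\<^bsup>1 - \<beta>\<^esup>\<close> (\<open>fractional_cesaro_dilation\<close>). The expression for the ball \<open>B\<close>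
  in the norm of \<open>D f\<close> is then \<open>\<bar>\<xi>\<bar>\<^bsup>- \<beta> - 1/q\<^esup>\<close> times the expression for the ball \<open>\<xi> B\<close> in the norm of
  \<open>f\<close>, where \<open>- 1/r\<close> comes from the outer integral and \<open>1/r - 1/q\<close> from the power of the volume
  (\<open>cesaro_morrey_local_dilation\<close>). Since \<open>B \<mapsto> \<xi> B\<close> permutes the balls, the suprema differ by the
  same factor. Boundedness follows from this identity
  once \<open>D f\<close> is known to be
  locally integrable, which is the case because \<open>\<xi> K\<close> is compact for compact \<open>K\<close>.

  The scaling law is obtained by comparing measures on balls. The value group of the absolute value
  is \<open>p\<^sup>\<int>\<close> (\<open>padic_norm_eq_power\<close>), so that \<open>\<xi> B\<close> is again a ball. Any two balls are nested or
  disjoint, and by density of the rationals every open set is a countable union of balls;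
  hence a Borel measure that is finite on balls is determined by their measures
  (\<open>padic_measure_eqI\<close>). Finally a ball of radius \<open>p\<^bsup>l+1\<^esup>\<close> splits into \<open>p\<close> translates of a ball of
  radius \<open>p\<^sup>l\<close>, one for each residue class, which forces the measure of a ball of radius \<open>p\<^sup>l\<close> to be
  \<open>p\<^sup>l\<close> (\<open>normalized_haar_measure_ball\<close>).\<close>

section \<open>The p-adic absolute value\<close>

lemma CARD_gt_1: "1 < real CARD('p::prime_card)"
  using prime_gt_1_nat[OF prime_card[where 'a='p]] by simp

lemma padic_norm_zero [simp]: "padic_norm 0 = 0"
  by (simp add: padic_norm_eq_0_iff)

lemma padic_norm_nonneg [simp]: "0 \<le> padic_norm x"
  using zero_le_dist[of x 0] by (simp add: dist_padic_def)

lemma padic_norm_pos: "x \<noteq> 0 \<Longrightarrow> 0 < padic_norm x"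
  using padic_norm_nonneg[of x] padic_norm_eq_0_iff[of x] by linarith

lemma padic_norm_minus_commute: "padic_norm (x - y) = padic_norm (y - x)"
  using dist_commute[of x y] by (simp add: dist_padic_def)

lemma padic_norm_mult: "padic_norm (x * y) = padic_norm x * padic_norm y"
proof transfer
  fix X Y :: "'a padic_seq"
  have "(\<lambda>n. padic_abs_rat CARD('a) (Rep_padic_seq (X * Y) n)) \<longlonglongrightarrow> abs_padic_seq X * abs_padic_seq Y"
    using tendsto_mult[OF abs_padic_seq_tendsto[of X] abs_padic_seq_tendsto[of Y]]
    by (simp add: times_padic_seq.rep_eq padic_abs_rat_mult[OF prime_card])
  then show "abs_padic_seq (X * Y) = abs_padic_seq X * abs_padic_seq Y"
    using abs_padic_seq_tendsto LIMSEQ_unique by blast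
qed

lemma padic_norm_inverse: "padic_norm (inverse x) = inverse (padic_norm x)"
proof (cases "x = 0")
  case False
  have "padic_norm (1 :: 'a padic) * padic_norm (1 :: 'a padic) = padic_norm (1 :: 'a padic)"
    by (simp flip: padic_norm_mult)
  then have "padic_norm (1 :: 'a padic) = 1"
    using padic_norm_pos[of "1 :: 'a padic"] by simp
  then have "padic_norm x * padic_norm (inverse x) = 1"
    using False by (simp flip: padic_norm_mult)
  then show ?thesis by (metis inverse_unique)
qed simp

lemma padic_norm_divide: "padic_norm (x / y) = padic_norm x / padic_norm y"
  by (simp add: divide_inverse padic_norm_mult padic_norm_inverse)

lemma padic_norm_add_le_max: "padic_norm (x + y) \<le> max (padic_norm x) (padic_norm y)"
proof transfer
  fix X Y :: "'a padic_seq"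
  show "abs_padic_seq (X + Y) \<le> max (abs_padic_seq X) (abs_padic_seq Y)"
    by (rule LIMSEQ_le[OF abs_padic_seq_tendsto tendsto_max[OF abs_padic_seq_tendsto abs_padic_seq_tendsto]])
       (simp add: plus_padic_seq.rep_eq padic_abs_rat_add_le_max[OF prime_card])
qed

lemma padic_norm_diff_le_max:
  "padic_norm (x - z) \<le> max (padic_norm (x - y)) (padic_norm (y - z))"
  using padic_norm_add_le_max[of "x - y" "y - z"] by simp

subsection \<open>Rational numbers\<close>

lift_definition padic_of_rat :: "rat \<Rightarrow> 'p::prime_card padic"
  is "\<lambda>c. Abs_padic_seq (\<lambda>n. c)" .

lemma Rep_const_padic_seq: "Rep_padic_seq (Abs_padic_seq (\<lambda>n. c) :: 'p::prime_card padic_seq) = (\<lambda>n. c)"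
  by (rule Abs_padic_seq_inverse) (simp add: padic_cauchy_const)

lemma padic_norm_of_rat:
  "padic_norm (padic_of_rat c :: 'p::prime_card padic) = padic_abs_rat CARD('p) c"
proof transfer
  fix c
  show "abs_padic_seq (Abs_padic_seq (\<lambda>n. c) :: 'p padic_seq) = padic_abs_rat CARD('p) c"
    using abs_padic_seq_tendsto[of "Abs_padic_seq (\<lambda>n. c) :: 'p padic_seq"]
    by (simp add: Rep_const_padic_seq LIMSEQ_const_iff)
qed

lemma padic_of_rat_diff: "padic_of_rat (a - b) = padic_of_rat a - padic_of_rat b"
proof transfer
  fix a b
  have "Abs_padic_seq (\<lambda>n. a - b) = Abs_padic_seq (\<lambda>n. a) - (Abs_padic_seq (\<lambda>n. b) :: 'a padic_seq)"
    by (simp add: Rep_const_padic_seq minus_padic_seq.rep_eq flip: Rep_padic_seq_inject)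
  then show "padic_rel (Abs_padic_seq (\<lambda>n. a - b)) (Abs_padic_seq (\<lambda>n. a) - (Abs_padic_seq (\<lambda>n. b) :: 'a padic_seq))"
    by (simp add: padic_rel_refl)
qed

text \<open>The terms of a Cauchy sequence that represents \<open>x\<close> eventually approximate \<open>x\<close>.\<close>

lemma padic_of_rat_dense:
  assumes "e > 0"
  shows "\<exists>c. padic_norm (x - padic_of_rat c) < e"
  using assms
proof transfer
  fix e :: real and X :: "'a padic_seq"
  assume e: "e > 0"
  have "padic_cauchy CARD('a) (Rep_padic_seq X)" using Rep_padic_seq by blast
  then obtain k where k: "\<forall>m\<ge>k. \<forall>n\<ge>k. padic_abs_rat CARD('a) (Rep_padic_seq X m - Rep_padic_seq X n) < e / 2"
    using e unfolding padic_cauchy_def by (meson half_gt_zero)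
  let ?Y = "X - Abs_padic_seq (\<lambda>n. Rep_padic_seq X k)"
  have "abs_padic_seq ?Y \<le> e / 2"
    by (rule LIMSEQ_le_const2[OF abs_padic_seq_tendsto])
       (use k in \<open>auto simp: minus_padic_seq.rep_eq Rep_const_padic_seq intro!: exI[of _ k] less_imp_le\<close>)
  then show "\<exists>c. abs_padic_seq (X - Abs_padic_seq (\<lambda>n. c)) < e"
    using e by (intro exI[of _ "Rep_padic_seq X k"]) auto
qed

text \<open>In an ultrametric triangle the two longest sides have equal length.\<close>

lemma padic_norm_eq_of_close:
  assumes "padic_norm (x - y) < padic_norm x"
  shows "padic_norm y = padic_norm x"
  using padic_norm_add_le_max[of y "x - y"] padic_norm_add_le_max[of x "- (x - y)"] assms
  by (simp add: padic_norm_minus_commute padic_norm_minus del: minus_diff_eq)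

text \<open>The absolute value of a sufficiently close rational number is that of \<open>x\<close>, so completing \<open>\<rat>\<close> does not
  enlarge the value group.\<close>

lemma padic_norm_eq_power:
  fixes x :: "'p::prime_card padic"
  assumes "x \<noteq> 0"
  obtains n where "padic_norm x = real CARD('p) powi n"
proof -
  obtain c where c: "padic_norm (x - padic_of_rat c) < padic_norm x"
    using padic_of_rat_dense[OF padic_norm_pos[OF assms]] by blast
  have "padic_abs_rat CARD('p) c = padic_norm x"
    using padic_norm_eq_of_close[OF c] by (simp add: padic_norm_of_rat)
  moreover from this have "c \<noteq> 0" using padic_norm_pos[OF assms] by auto
  moreover obtain a b where "quotient_of c = (a, b)" by force
  ultimately have "padic_norm x =
      real CARD('p) powi (int (multiplicity (int CARD('p)) b) - int (multiplicity (int CARD('p)) a))"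
    by (simp add: padic_abs_rat_def)
  then show thesis by (rule that)
qed

lemma padic_norm_power_exists: "\<exists>x :: 'p::prime_card padic. padic_norm x = real CARD('p) powi n"
proof -
  have p: "prime CARD('p)" by (rule prime_card)
  have 1: "padic_abs_rat CARD('p) (of_int (int CARD('p))) = inverse (real CARD('p))"
    using padic_abs_rat_of_int_div[OF p, of "int CARD('p)" 1] prime_gt_1_nat[OF p]
    by (simp add: power_int_minus multiplicity_self)
  have pow: "padic_abs_rat CARD('p) (of_int (int CARD('p)) ^ k) = inverse (real CARD('p)) ^ k" for k
    by (induction k) (simp_all only: power_0 power_Suc padic_abs_rat_one[OF p] padic_abs_rat_mult[OF p] 1)
  \<comment> \<open>The witness is \<open>p\<^bsup>- n\<^esup>\<close>, since \<open>\<bar>p\<bar> = p\<^bsup>- 1\<^esup>\<close>.\<close>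
  have "padic_abs_rat CARD('p) (of_int (int CARD('p)) powi (-n)) = real CARD('p) powi n"
    by (cases "n \<ge> 0")
       (simp_all add: power_int_def pow padic_abs_rat_inverse[OF p] padic_abs_rat_one[OF p] power_inverse del: of_int_of_nat_eq)
  then show ?thesis
    using padic_norm_of_rat by metis
qed

subsection \<open>Residue classes\<close>

text \<open>In lowest terms \<open>c = a / b\<close> with \<open>b\<close> prime to \<open>p\<close>, so the residue class of \<open>c\<close> is that of
  \<open>a \<cdot> b\<^bsup>- 1\<^esup>\<close> modulo \<open>p\<close>.\<close>

lemma residue_exists_rat:
  assumes p: "prime p" and c: "padic_abs_rat p c \<le> 1"
  shows "\<exists>i<p. padic_abs_rat p (c - of_nat i) \<le> inverse (real p)"
proof (cases "c = 0")
  case True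
  then show ?thesis using prime_gt_0_nat[OF p] by (intro exI[of _ 0]) auto
next
  case False
  have p1: "real p > 1" using prime_gt_1_nat[OF p] by simp
  have pu: "\<not> is_unit (int p)" using prime_gt_1_nat[OF p] by simp
  obtain a b where ab: "quotient_of c = (a, b)" by force
  have b: "b > 0" and cop: "coprime a b" and cab: "c = of_int a / of_int b"
    using quotient_of_denom_pos[OF ab] quotient_of_coprime[OF ab] quotient_of_div[OF ab] by auto
  have "real p powi (int (multiplicity (int p) b) - int (multiplicity (int p) a)) \<le> real p powi 0"
    using c False ab by (simp add: padic_abs_rat_def)
  then have mult: "multiplicity (int p) b \<le> multiplicity (int p) a"
    using power_int_strict_increasing[of 0 "int (multiplicity (int p) b) - int (multiplicity (int p) a)" "real p"] p1
    by fastforce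
  \<comment> \<open>If \<open>p\<close> divided the denominator, then \<open>\<bar>c\<bar> \<le> 1\<close> would make it divide the numerator as well.\<close>
  have nd: "\<not> int p dvd b"
  proof
    assume d: "int p dvd b"
    then have "multiplicity (int p) b > 0"
      using b pu by (simp add: multiplicity_gt_zero_iff)
    then have "int p dvd a"
      using mult not_dvd_imp_multiplicity_0[of "int p" a] by fastforce
    with d cop pu show False by (meson coprime_common_divisor)
  qed
  then have "coprime b (int p)"
    using p prime_imp_coprime[of "int p" b] by (simp add: coprime_commute)
  then obtain u where u: "[b * u = 1] (mod int p)"
    using cong_solve_coprime_int by blast
  define i where "i = nat ((a * u) mod int p)"
  have p0: "int p > 0" using prime_gt_0_nat[OF p] by simp
  have ii: "int i = (a * u) mod int p" using p0 by (simp add: i_def)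
  have i: "i < p" using p0 by (simp add: i_def nat_less_iff)
  have "[b * int i = b * (a * u)] (mod int p)"
    unfolding ii by (intro cong_mult cong_refl) (simp add: cong_def)
  also have "b * (a * u) = a * (b * u)" by simp
  also have "[a * (b * u) = a * 1] (mod int p)"
    by (intro cong_mult cong_refl u)
  finally have dvd: "int p dvd a - int i * b"
    by (simp add: cong_iff_dvd_diff dvd_diff_commute mult.commute)
  have eq: "c - of_nat i = of_int (a - int i * b) / of_int b"
    using b by (simp add: cab field_simps)
  have "padic_abs_rat p (c - of_nat i) \<le> inverse (real p)"
  proof (cases "a - int i * b = 0")
    case True
    then show ?thesis unfolding eq by simp
  next
    case nz: False
    have "multiplicity (int p) (a - int i * b) \<ge> 1"
      using dvd nz pu by (intro multiplicity_geI) auto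
    then have "real p powi (int (multiplicity (int p) b) - int (multiplicity (int p) (a - int i * b)))
        \<le> real p powi (-1)"
      using p1 nd by (intro power_int_increasing) (auto simp: not_dvd_imp_multiplicity_0)
    then show ?thesis
      unfolding eq using nz b p1 by (subst padic_abs_rat_of_int_div[OF p]) (auto simp: power_int_minus)
  qed
  with i show ?thesis by blast
qed

lemma residue_unique_rat:
  assumes p: "prime p" and ij: "i < p" "j < p" "i \<noteq> j"
  shows "padic_abs_rat p (of_nat i - of_nat j) = 1"
proof -
  have "\<not> int p dvd int i - int j"
  proof
    assume "int p dvd int i - int j"
    then have "int p \<le> \<bar>int i - int j\<bar>" using ij(3) by (intro zdvd_imp_le) auto
    with ij show False by linarith
  qed
  then show ?thesis
    using padic_abs_rat_of_int_div[OF p, of "int i - int j" 1] ij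
    by (simp add: not_dvd_imp_multiplicity_0)
qed

lemma residue_exists:
  fixes x :: "'p::prime_card padic"
  assumes "padic_norm x \<le> 1"
  shows "\<exists>i<CARD('p). padic_norm (x - padic_of_rat (of_nat i)) \<le> inverse (real CARD('p))"
proof -
  have p: "prime CARD('p)" by (rule prime_card)
  have p1: "real CARD('p) > 1" by (rule CARD_gt_1)
  then have "inverse (real CARD('p)) > 0" by simp
  then obtain c where c: "padic_norm (x - padic_of_rat c) < inverse (real CARD('p))"
    using padic_of_rat_dense by blast
  have "inverse (real CARD('p)) \<le> 1" using p1 by (simp add: field_simps)
  then have "padic_norm (padic_of_rat c :: 'p padic) \<le> 1"
    using padic_norm_diff_le_max[of "padic_of_rat c" 0 x] assms c
      padic_norm_minus_commute[of x "padic_of_rat c"] by simp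
  then obtain i where i: "i < CARD('p)" "padic_abs_rat CARD('p) (c - of_nat i) \<le> inverse (real CARD('p))"
    using residue_exists_rat[OF p] by (auto simp: padic_norm_of_rat)
  then have "padic_norm (padic_of_rat c - padic_of_rat (of_nat i) :: 'p padic) \<le> inverse (real CARD('p))"
    by (simp add: padic_norm_of_rat flip: padic_of_rat_diff)
  then show ?thesis
    using i c padic_norm_diff_le_max[of x "padic_of_rat (of_nat i)" "padic_of_rat c"]
    by (intro exI[of _ i]) auto
qed


section \<open>Balls\<close>

lemma padic_ball_iff: "x \<in> padic_ball (a :: 'p::prime_card padic) l \<longleftrightarrow> padic_norm (x - a) \<le> real CARD('p) powi l"
  by (simp add: padic_ball_def)

text \<open>By the ultrametric inequality each point of a ball is a centre of it; in particular, two balls that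
  meet are nested.\<close>

lemma padic_ball_subset:
  fixes a b :: "'p::prime_card padic"
  assumes "x \<in> padic_ball a l" "x \<in> padic_ball b k" "l \<le> k"
  shows "padic_ball a l \<subseteq> padic_ball b k"
proof
  fix y assume y: "y \<in> padic_ball a l"
  have "real CARD('p) powi l \<le> real CARD('p) powi k"
    using assms(3) CARD_gt_1[where 'p='p] by (intro power_int_increasing) auto
  then show "y \<in> padic_ball b k"
    using assms(1,2) y padic_norm_diff_le_max[of y x a] padic_norm_diff_le_max[of y b x]
    by (auto simp: padic_ball_iff padic_norm_minus_commute[of a x])
qed

lemma padic_norm_le_power: "\<exists>n. padic_norm (x :: 'p::prime_card padic) \<le> real CARD('p) powi int n"
proof -
  obtain n where "padic_norm x < real CARD('p) ^ n"
    using real_arch_pow[OF CARD_gt_1] by blast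
  then show ?thesis by (intro exI[of _ n]) auto
qed

lemma padic_ball_UN: "(\<Union>n. padic_ball (0 :: 'p::prime_card padic) (int n)) = UNIV"
  using padic_norm_le_power by (auto simp: padic_ball_iff)

text \<open>A point of \<open>U\<close> is a centre of a small ball inside \<open>U\<close>, and so is any rational number in that ball. Thus
  the countably many balls with rational centres form a basis of the topology.\<close>

lemma open_imp_padic_ball_of_rat:
  fixes U :: "'p::prime_card padic set"
  assumes "open U" "x \<in> U"
  shows "\<exists>c l. x \<in> padic_ball (padic_of_rat c) l \<and> padic_ball (padic_of_rat c) l \<subseteq> U"
proof -
  obtain e where e: "e > 0" "ball x e \<subseteq> U"
    using assms openE by blast
  obtain n where n: "inverse (real CARD('p)) ^ n < e"
    using real_arch_pow_inv[OF e(1), of "inverse (real CARD('p))"] CARD_gt_1[where 'p='p]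
    by (auto simp: field_simps)
  define l where "l = - int n"
  have l: "real CARD('p) powi l < e"
    using n by (simp add: l_def power_int_minus power_inverse)
  have "real CARD('p) powi l > 0" using CARD_gt_1[where 'p='p] by simp
  then obtain c where c: "padic_norm (x - padic_of_rat c) < real CARD('p) powi l"
    using padic_of_rat_dense by blast
  then have x: "x \<in> padic_ball (padic_of_rat c) l" by (simp add: padic_ball_iff)
  have xx: "x \<in> padic_ball x l" using CARD_gt_1[where 'p='p] by (simp add: padic_ball_iff)
  have "padic_ball (padic_of_rat c) l \<subseteq> padic_ball x l"
    using padic_ball_subset[OF x xx] by simp
  also have "\<dots> \<subseteq> ball x e"
    using l by (auto simp: padic_ball_iff dist_padic_def padic_norm_minus_commute[of x])
  finally show ?thesis using x e(2) by blast
qed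

lemma closed_padic_ball: "closed (padic_ball a l)"
proof -
  have "padic_ball a l = cball a (real CARD('a) powi l)"
    by (auto simp: padic_ball_iff dist_padic_def padic_norm_minus_commute[of _ a])
  then show ?thesis by simp
qed

lemma borel_padic_ball [measurable]: "padic_ball a l \<in> sets borel"
  by (rule borel_closed[OF closed_padic_ball])

text \<open>The empty set is included so that the generator is closed under intersections.\<close>

lemma sets_borel_eq_balls:
  "sets (borel :: 'p::prime_card padic measure) =
    sigma_sets UNIV (insert {} (range (\<lambda>(a, l). padic_ball a l)))"
  (is "_ = sigma_sets UNIV ?E")
proof -
  have "sigma_sets UNIV (Collect open) = sigma_sets UNIV ?E"
  proof (rule sigma_sets_eqI)
    fix U :: "'p padic set" assume "U \<in> Collect open"
    then have "open U" by simp
    define I where "I = {(c, l). padic_ball (padic_of_rat c) l \<subseteq> U}"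
    have "countable I" by (rule countableI_type)
    moreover have "padic_ball (padic_of_rat c) l \<in> sigma_sets UNIV ?E" for c l
      by (rule sigma_sets.Basic) auto
    ultimately have "(\<Union>(c, l)\<in>I. padic_ball (padic_of_rat c) l) \<in> sigma_sets UNIV ?E"
      by (intro sigma_sets_UNION) auto
    moreover have "(\<Union>(c, l)\<in>I. padic_ball (padic_of_rat c) l) = U"
      using open_imp_padic_ball_of_rat[OF \<open>open U\<close>] by (fastforce simp: I_def)
    ultimately show "U \<in> sigma_sets UNIV ?E" by simp
  next
    fix B :: "'p padic set" assume "B \<in> ?E"
    then have "B \<in> sets borel" using borel_padic_ball by auto
    then show "B \<in> sigma_sets UNIV (Collect open)" by (simp add: sets_borel)
  qed
  then show ?thesis by (simp add: sets_borel)
qed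

lemma Int_stable_balls: "Int_stable (insert {} (range (\<lambda>(a :: 'p::prime_card padic, l). padic_ball a l)))"
proof (rule Int_stableI)
  fix A B :: "'p padic set"
  let ?E = "insert {} (range (\<lambda>(a :: 'p::prime_card padic, l). padic_ball a l))"
  assume A: "A \<in> ?E" and B: "B \<in> ?E"
  show "A \<inter> B \<in> ?E"
  proof (cases "A \<inter> B = {}")
    case False
    then obtain x where x: "x \<in> A" "x \<in> B" by blast
    with A B obtain a l b k where "A = padic_ball a l" "B = padic_ball b k" by auto
    then have "A \<subseteq> B \<or> B \<subseteq> A"
      using x padic_ball_subset[of x a l b k] padic_ball_subset[of x b k a l] by fastforce
    then have "A \<inter> B = A \<or> A \<inter> B = B" by blast
    with A B show ?thesis by metis
  qed simp
qed

lemma padic_measure_eqI: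
  fixes M N :: "'p::prime_card padic measure"
  assumes "sets M = sets borel" "sets N = sets borel"
    and eq: "\<And>a l. emeasure M (padic_ball a l) = emeasure N (padic_ball a l)"
    and fin: "\<And>l. emeasure M (padic_ball 0 l) \<noteq> \<infinity>"
  shows "M = N"
proof (rule measure_eqI_generator_eq[OF Int_stable_balls])
  show "(\<Union>n. padic_ball (0 :: 'p padic) (int n)) = UNIV" by (rule padic_ball_UN)
qed (use assms in \<open>auto simp: sets_borel_eq_balls\<close>)

section \<open>Haar measure of balls\<close>

text \<open>The map \<open>x \<mapsto> (x - a) / s\<close> takes the ball to the unit ball, which is partitioned by the residue classes
  \<open>0, \<dots>, p - 1\<close>.\<close>

lemma padic_ball_Suc:
  fixes a :: "'p::prime_card padic"
  assumes s: "padic_norm s = real CARD('p) powi (l + 1)"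
  shows "padic_ball a (l + 1) = (\<Union>i<CARD('p). padic_ball (a + s * padic_of_rat (of_nat i)) l)"
    and "disjoint_family_on (\<lambda>i. padic_ball (a + s * padic_of_rat (of_nat i)) l) {..<CARD('p)}"
proof -
  have p: "prime CARD('p)" by (rule prime_card)
  have p1: "real CARD('p) > 1" by (rule CARD_gt_1)
  have s0: "padic_norm s > 0" using s p1 by simp
  then have "s \<noteq> 0" by auto
  have l: "real CARD('p) powi l = padic_norm s * inverse (real CARD('p))"
    using p1 by (simp add: s power_int_add)
  have big: "x \<in> padic_ball a (l + 1) \<longleftrightarrow> padic_norm ((x - a) / s) \<le> 1" for x
    using s0 by (simp add: padic_ball_iff padic_norm_divide flip: s)
  have small: "x \<in> padic_ball (a + s * c) l \<longleftrightarrow> padic_norm ((x - a) / s - c) \<le> inverse (real CARD('p))" for x c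
  proof -
    have "x - (a + s * c) = s * ((x - a) / s - c)"
      using \<open>s \<noteq> 0\<close> by (simp add: field_simps)
    then show ?thesis
      using s0 by (simp add: padic_ball_iff l padic_norm_mult)
  qed
  have le1: "inverse (real CARD('p)) < 1" using p1 by (simp add: field_simps)
  \<comment> \<open>Integers lie in the unit ball, hence so do the residue classes around them.\<close>
  have int: "padic_norm (padic_of_rat (of_nat i) :: 'p padic) \<le> 1" for i
  proof (cases "i = 0")
    case False
    have "real CARD('p) powi (- int (multiplicity (int CARD('p)) (int i))) \<le> real CARD('p) powi 0"
      using p1 by (intro power_int_increasing) auto
    then show ?thesis
      using padic_abs_rat_of_int_div[OF p, of "int i" 1] False by (simp add: padic_norm_of_rat)
  qed (simp add: padic_norm_of_rat)
  show "padic_ball a (l + 1) = (\<Union>i<CARD('p). padic_ball (a + s * padic_of_rat (of_nat i)) l)"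
  proof (intro equalityI subsetI)
    fix x assume "x \<in> padic_ball a (l + 1)"
    then show "x \<in> (\<Union>i<CARD('p). padic_ball (a + s * padic_of_rat (of_nat i)) l)"
      using residue_exists[of "(x - a) / s"] by (auto simp: big small)
  next
    fix x assume "x \<in> (\<Union>i<CARD('p). padic_ball (a + s * padic_of_rat (of_nat i)) l)"
    then obtain i where "padic_norm ((x - a) / s - padic_of_rat (of_nat i)) \<le> inverse (real CARD('p))"
      by (auto simp: small)
    then show "x \<in> padic_ball a (l + 1)"
      unfolding big
      using le1 int[of i] padic_norm_diff_le_max[of "(x - a) / s" 0 "padic_of_rat (of_nat i)"] by simp
  qed
  show "disjoint_family_on (\<lambda>i. padic_ball (a + s * padic_of_rat (of_nat i)) l) {..<CARD('p)}"
  proof (unfold disjoint_family_on_def, intro ballI impI equals0I)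
    fix i j x assume ij: "i \<in> {..<CARD('p)}" "j \<in> {..<CARD('p)}" "i \<noteq> j"
      and "x \<in> padic_ball (a + s * padic_of_rat (of_nat i)) l \<inter> padic_ball (a + s * padic_of_rat (of_nat j)) l"
    then have "padic_norm (padic_of_rat (of_nat i) - padic_of_rat (of_nat j) :: 'p padic) \<le> inverse (real CARD('p))"
      using padic_norm_diff_le_max[of "padic_of_rat (of_nat i)" "padic_of_rat (of_nat j)" "(x - a) / s"]
        padic_norm_minus_commute[of "(x - a) / s" "padic_of_rat (of_nat i)"]
      by (auto simp: small)
    then show False
      using residue_unique_rat[OF p, of i j] ij le1
      by (simp add: padic_norm_of_rat flip: padic_of_rat_diff)
  qed
qed

lemma haar_measure_sets: "haar_measure \<mu> \<Longrightarrow> sets \<mu> = sets borel"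
  by (simp add: haar_measure_def)

lemma normalized_haar_measure_sets: "normalized_haar_measure \<mu> \<Longrightarrow> sets \<mu> = sets borel"
  by (simp add: normalized_haar_measure_def haar_measure_sets)

lemma haar_measure_ball_translate:
  assumes "haar_measure \<mu>"
  shows "emeasure \<mu> (padic_ball a l) = emeasure \<mu> (padic_ball 0 l)"
proof -
  have "(\<lambda>x. a + x) ` padic_ball 0 l = padic_ball a l"
    by (auto simp: padic_ball_iff image_iff intro!: bexI[of _ "x - a" for x])
  moreover have "padic_ball 0 l \<in> sets borel" by (rule borel_padic_ball)
  ultimately show ?thesis using assms unfolding haar_measure_def by metis
qed

lemma haar_measure_ball_Suc:
  fixes \<mu> :: "'p::prime_card padic measure"
  assumes "haar_measure \<mu>"
  shows "emeasure \<mu> (padic_ball 0 (l + 1)) = of_nat CARD('p) * emeasure \<mu> (padic_ball 0 l)"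
proof -
  obtain s :: "'p padic" where s: "padic_norm s = real CARD('p) powi (l + 1)"
    using padic_norm_power_exists by blast
  have "(\<Sum>i<CARD('p). emeasure \<mu> (padic_ball (0 + s * padic_of_rat (of_nat i)) l)) =
      emeasure \<mu> (padic_ball 0 (l + 1))"
    unfolding padic_ball_Suc(1)[OF s, of 0] using padic_ball_Suc(2)[OF s, of 0] borel_padic_ball
    by (intro sum_emeasure) (auto simp: haar_measure_sets[OF assms])
  then show ?thesis
    by (subst (asm) haar_measure_ball_translate[OF assms]) simp
qed

text \<open>The partition into \<open>p\<close> translates determines the measure of all balls from that of the unit ball, by
  induction on the radius in both directions.\<close>

lemma normalized_haar_measure_ball:
  fixes \<mu> :: "'p::prime_card padic measure"
  assumes "normalized_haar_measure \<mu>"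
  shows "emeasure \<mu> (padic_ball a l) = ennreal (real CARD('p) powi l)"
proof -
  have haar: "haar_measure \<mu>" using assms by (simp add: normalized_haar_measure_def)
  have p1: "real CARD('p) > 1" by (rule CARD_gt_1)
  have step: "emeasure \<mu> (padic_ball 0 (k + 1)) = ennreal (real CARD('p)) * emeasure \<mu> (padic_ball 0 k)" for k
    using haar_measure_ball_Suc[OF haar] by (simp add: ennreal_of_nat_eq_real_of_nat)
  have "emeasure \<mu> (padic_ball 0 l) = ennreal (real CARD('p) powi l)"
  proof (induction l rule: int_induct[where k = 0])
    case base
    have "padic_ball (0 :: 'p padic) 0 = {x. padic_norm x \<le> 1}" by (simp add: padic_ball_def)
    then show ?case using assms by (simp add: normalized_haar_measure_def)
  next
    case (step1 i)
    then show ?case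
      using p1 unfolding step by (simp add: power_int_add ennreal_mult'[symmetric] mult.commute)
  next
    case (step2 i)
    have "emeasure \<mu> (padic_ball 0 (i - 1)) =
        ennreal (inverse (real CARD('p)) * real CARD('p)) * emeasure \<mu> (padic_ball 0 (i - 1))"
      using p1 by simp
    also have "\<dots> = ennreal (inverse (real CARD('p))) * ennreal (real CARD('p) powi i)"
      using step[of "i - 1"] step2(2) by (simp only: ennreal_mult'' of_nat_0_le_iff mult.assoc diff_add_cancel)
    also have "\<dots> = ennreal (real CARD('p) powi (i - 1))"
      using p1 by (simp add: power_int_diff ennreal_mult'[symmetric] field_simps)
    finally show ?case .
  qed
  then show ?thesis using haar_measure_ball_translate[OF haar] by metis
qed


section \<open>Dilations and Haar measure\<close>

lemma continuous_on_padic_mult: "continuous_on UNIV (\<lambda>x. c * x :: 'p::prime_card padic)"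
proof (rule lipschitz_on_continuous_on)
  show "(padic_norm c)-lipschitz_on UNIV (\<lambda>x. c * x)"
    by (rule lipschitz_onI) (simp_all add: dist_padic_def padic_norm_mult flip: right_diff_distrib)
qed

lemma borel_padic_mult [measurable]: "(\<lambda>x. c * x :: 'p::prime_card padic) \<in> borel \<rightarrow>\<^sub>M borel"
  by (rule borel_measurable_continuous_onI[OF continuous_on_padic_mult])

lemma padic_mult_mem_ball_iff:
  fixes \<xi> :: "'p::prime_card padic"
  assumes v: "padic_norm \<xi> = real CARD('p) powi v" and "\<xi> \<noteq> 0"
  shows "\<xi> * x \<in> padic_ball (\<xi> * a) (l + v) \<longleftrightarrow> x \<in> padic_ball a l"
  using padic_norm_pos[OF assms(2)] CARD_gt_1[where 'p='p]
  by (simp add: padic_ball_iff padic_norm_mult power_int_add flip: right_diff_distrib v)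

text \<open>The preimage of a ball of radius \<open>p\<^sup>l\<close> is a ball of radius \<open>p\<^sup>l / \<bar>\<xi>\<bar>\<close>, so both measures agree on balls.\<close>

lemma haar_measure_dilation:
  fixes \<mu> :: "'p::prime_card padic measure"
  assumes \<mu>: "normalized_haar_measure \<mu>" and "\<xi> \<noteq> 0"
  shows "\<mu> = density (distr \<mu> borel (\<lambda>x. \<xi> * x)) (\<lambda>_. ennreal (padic_norm \<xi>))" (is "_ = ?D")
proof (rule padic_measure_eqI)
  show sets: "sets \<mu> = sets borel"
    by (rule normalized_haar_measure_sets[OF \<mu>])
  then have space: "space \<mu> = UNIV" using sets_eq_imp_space_eq by fastforce
  have T: "(\<lambda>x. \<xi> * x) \<in> \<mu> \<rightarrow>\<^sub>M borel"
    using borel_padic_mult measurable_cong_sets[OF sets refl] by blast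
  obtain v where v: "padic_norm \<xi> = real CARD('p) powi v"
    using padic_norm_eq_power[OF assms(2)] by blast
  have p1: "real CARD('p) > 1" by (rule CARD_gt_1)
  show "emeasure \<mu> (padic_ball a l) = emeasure ?D (padic_ball a l)" for a l
  proof -
    have "(\<lambda>x. \<xi> * x) -` padic_ball a l \<inter> space \<mu> = padic_ball (a / \<xi>) (l - v)"
      using padic_mult_mem_ball_iff[OF v assms(2), of _ "a / \<xi>" "l - v"] assms(2) by (auto simp: space)
    then have "emeasure ?D (padic_ball a l) = ennreal (padic_norm \<xi>) * ennreal (real CARD('p) powi (l - v))"
      using T by (simp add: emeasure_density_const emeasure_distr normalized_haar_measure_ball[OF \<mu>])
    also have "\<dots> = ennreal (real CARD('p) powi l)"
      using p1 by (simp add: v power_int_diff ennreal_mult'[symmetric])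
    finally show ?thesis by (simp add: normalized_haar_measure_ball[OF \<mu>])
  qed
qed (simp_all add: normalized_haar_measure_ball[OF \<mu>])

text \<open>Since \<open>x \<mapsto> \<xi> x\<close> preserves null sets in both directions, the scaling law passes to the completion.\<close>

lemma
  fixes \<mu> :: "'p::prime_card padic measure"
  assumes \<mu>: "normalized_haar_measure \<mu>" and "\<xi> \<noteq> 0"
  shows measurable_completion_dilation: "(\<lambda>x. \<xi> * x) \<in> completion \<mu> \<rightarrow>\<^sub>M completion \<mu>"
    and completion_eq_density_distr: "completion \<mu> =
      density (distr (completion \<mu>) (completion \<mu>) (\<lambda>x. \<xi> * x)) (\<lambda>_. ennreal (padic_norm \<xi>))"
proof -
  let ?T = "\<lambda>x. \<xi> * x" and ?n = "ennreal (padic_norm \<xi>)"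
  have n: "?n > 0" using padic_norm_pos[OF assms(2)] by simp
  have sets: "sets \<mu> = sets borel"
    by (rule normalized_haar_measure_sets[OF \<mu>])
  have T: "?T \<in> \<mu> \<rightarrow>\<^sub>M \<mu>"
    using borel_padic_mult[of \<xi>] measurable_cong_sets[OF sets sets] by blast
  have distr_eq: "distr \<mu> borel ?T = distr \<mu> \<mu> ?T"
    by (rule distr_cong) (simp_all add: sets)
  have \<mu>_eq: "\<mu> = density (distr \<mu> \<mu> ?T) (\<lambda>_. ?n)"
    using haar_measure_dilation[OF assms] by (simp only: distr_eq)
  have "emeasure \<mu> A = 0 \<longleftrightarrow> emeasure (distr \<mu> \<mu> ?T) A = 0" if "A \<in> sets \<mu>" for A
    using that n by (subst \<mu>_eq) (simp add: emeasure_density_const)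
  then have null: "null_sets (distr (completion \<mu>) \<mu> ?T) = null_sets \<mu>"
    using T by (auto simp: null_sets_def distr_completion)
  show "?T \<in> completion \<mu> \<rightarrow>\<^sub>M completion \<mu>"
    using T by (simp add: completion.measurable_completion2 null measurable_completion)
  have "completion \<mu> = completion (density (distr \<mu> \<mu> ?T) (\<lambda>_. ?n))"
    using \<mu>_eq by simp
  also have "\<dots> = density (completion (distr (completion \<mu>) \<mu> ?T)) (\<lambda>_. ?n)"
    using n T by (simp add: completion_density_eq distr_completion)
  also have "\<dots> = density (distr (completion \<mu>) (completion \<mu>) ?T) (\<lambda>_. ?n)"
    using T by (subst completion.completion_distr_eq) (auto simp: null measurable_completion)
  finally show "completion \<mu> = density (distr (completion \<mu>) (completion \<mu>) ?T) (\<lambda>_. ?n)" .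
qed

lemma nn_integral_dilation:
  fixes \<mu> :: "'p::prime_card padic measure"
  assumes \<mu>: "normalized_haar_measure \<mu>" and "\<xi> \<noteq> 0"
    and g: "g \<in> borel_measurable (completion \<mu>)"
  shows "(\<integral>\<^sup>+x. g (\<xi> * x) \<partial>completion \<mu>) = ennreal (inverse (padic_norm \<xi>)) * (\<integral>\<^sup>+x. g x \<partial>completion \<mu>)"
proof -
  have n: "padic_norm \<xi> > 0" by (rule padic_norm_pos[OF assms(2)])
  note [measurable] = measurable_completion_dilation[OF assms(1,2)] g
  have "(\<integral>\<^sup>+x. g x \<partial>completion \<mu>) = ennreal (padic_norm \<xi>) * (\<integral>\<^sup>+x. g (\<xi> * x) \<partial>completion \<mu>)"
    by (subst completion_eq_density_distr[OF assms(1,2)])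
       (simp add: nn_integral_density nn_integral_distr nn_integral_cmult)
  then have "ennreal (inverse (padic_norm \<xi>)) * (\<integral>\<^sup>+x. g x \<partial>completion \<mu>) =
      ennreal (inverse (padic_norm \<xi>) * padic_norm \<xi>) * (\<integral>\<^sup>+x. g (\<xi> * x) \<partial>completion \<mu>)"
    by (simp add: ennreal_mult mult.assoc)
  with n show ?thesis by simp
qed

lemma integrable_dilation:
  fixes \<mu> :: "'p::prime_card padic measure" and g :: "'p padic \<Rightarrow> 'b::{banach, second_countable_topology}"
  assumes \<mu>: "normalized_haar_measure \<mu>" and "\<xi> \<noteq> 0"
    and g: "integrable (completion \<mu>) g"
  shows "integrable (completion \<mu>) (\<lambda>x. g (\<xi> * x))"
proof -
  note [measurable] = measurable_completion_dilation[OF assms(1,2)] borel_measurable_integrable[OF g]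
  have "(\<integral>\<^sup>+x. norm (g (\<xi> * x)) \<partial>completion \<mu>) =
      ennreal (inverse (padic_norm \<xi>)) * (\<integral>\<^sup>+x. norm (g x) \<partial>completion \<mu>)"
    by (rule nn_integral_dilation[OF assms(1,2)]) measurable
  also have "\<dots> < \<infinity>"
    using g by (auto simp: integrable_iff_bounded ennreal_mult_less_top)
  finally show ?thesis by (intro integrableI_bounded) measurable
qed

text \<open>Since \<open>x \<mapsto> \<xi> x\<close> is invertible, \<open>g\<close> and its dilation are integrable together; for any other \<open>g\<close> both
  integrals have the default value \<open>0\<close>.\<close>

lemma integral_dilation:
  fixes \<mu> :: "'p::prime_card padic measure" and g :: "'p padic \<Rightarrow> 'b::{banach, second_countable_topology}"
  assumes \<mu>: "normalized_haar_measure \<mu>" and "\<xi> \<noteq> 0"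
  shows "(LINT x|completion \<mu>. g (\<xi> * x)) = inverse (padic_norm \<xi>) *\<^sub>R (LINT x|completion \<mu>. g x)"
proof (cases "integrable (completion \<mu>) g")
  case True
  have n: "padic_norm \<xi> > 0" by (rule padic_norm_pos[OF assms(2)])
  note [measurable] = measurable_completion_dilation[OF assms(1,2)] borel_measurable_integrable[OF True]
  have "(LINT x|completion \<mu>. g x) = padic_norm \<xi> *\<^sub>R (LINT x|completion \<mu>. g (\<xi> * x))"
    by (subst completion_eq_density_distr[OF assms(1,2)])
       (simp add: integral_density integral_distr)
  with n show ?thesis by simp
next
  case False
  \<comment> \<open>Otherwise dilating back by \<open>\<xi>\<^bsup>- 1\<^esup>\<close> would make \<open>g\<close> integrable.\<close>
  have "\<not> integrable (completion \<mu>) (\<lambda>x. g (\<xi> * x))"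
    using integrable_dilation[OF \<mu>, of "inverse \<xi>" "\<lambda>x. g (\<xi> * x)"] assms(2) False
    by (auto simp: mult.assoc[symmetric])
  with False show ?thesis by (simp add: not_integrable_integral_eq)
qed

lemma locally_integrable_dilation:
  fixes \<mu> :: "'p::prime_card padic measure"
  assumes \<mu>: "normalized_haar_measure \<mu>" and "\<xi> \<noteq> 0" and f: "locally_integrable \<mu> f"
  shows "locally_integrable \<mu> (dilation \<xi> f)"
  unfolding locally_integrable_def set_integrable_def
proof (intro allI impI)
  fix K :: "'p padic set" assume "compact K"
  then have "compact ((\<lambda>x. \<xi> * x) ` K)"
    by (intro compact_continuous_image continuous_on_subset[OF continuous_on_padic_mult]) auto
  then have "integrable (completion \<mu>) (\<lambda>x. indicator ((\<lambda>x. \<xi> * x) ` K) x *\<^sub>R f x)"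
    using f by (simp add: locally_integrable_def set_integrable_def)
  from integrable_dilation[OF assms(1,2) this]
  show "integrable (completion \<mu>) (\<lambda>x. indicator K x *\<^sub>R dilation \<xi> f x)"
    using assms(2) by (simp add: dilation_def indicator_def image_iff)
qed

section \<open>The Cesaro average and the Morrey norm of a dilated function\<close>

lemma fractional_cesaro_dilation:
  fixes \<mu> :: "'p::prime_card padic measure"
  assumes \<mu>: "normalized_haar_measure \<mu>" and "\<xi> \<noteq> 0"
  shows "fractional_cesaro \<mu> \<beta> (dilation \<xi> f) x =
    padic_norm \<xi> powr (- \<beta>) * fractional_cesaro \<mu> \<beta> f (\<xi> * x)"
proof -
  let ?n = "padic_norm \<xi>"
  have n: "?n > 0" by (rule padic_norm_pos[OF assms(2)])
  have "(LINT t:{t. padic_norm t \<le> padic_norm x}|completion \<mu>. norm (dilation \<xi> f t)) =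
      inverse ?n * (LINT t:{t. padic_norm t \<le> padic_norm (\<xi> * x)}|completion \<mu>. norm (f t))"
    using integral_dilation[OF assms, of "\<lambda>t. indicator {t. padic_norm t \<le> padic_norm (\<xi> * x)} t *\<^sub>R norm (f t)"] n
    by (simp add: set_lebesgue_integral_def dilation_def indicator_def padic_norm_mult)
  moreover have "1 / padic_norm x powr (1 - \<beta>) * (inverse ?n * I) =
      ?n powr (- \<beta>) * (1 / padic_norm (\<xi> * x) powr (1 - \<beta>) * I)" for I
    using n by (simp add: padic_norm_mult powr_mult powr_diff powr_minus field_simps)
  ultimately show ?thesis by (simp add: fractional_cesaro_def)
qed

lemma fractional_cesaro_nonneg: "0 \<le> fractional_cesaro \<mu> \<beta> f x"
  by (simp add: fractional_cesaro_def set_lebesgue_integral_def)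

text \<open>The absolute value is a measurable function with countably many values. The result applies to the Cesaro
  average, which depends on \<open>x\<close> through its absolute value only.\<close>

lemma borel_measurable_comp_padic_norm:
  fixes h :: "real \<Rightarrow> real"
  shows "(\<lambda>x :: 'p::prime_card padic. h (padic_norm x)) \<in> borel_measurable borel"
proof -
  let ?R = "range (padic_norm :: 'p padic \<Rightarrow> real)"
  have "?R \<subseteq> insert 0 (range (\<lambda>n. real CARD('p) powi n))"
  proof (rule image_subsetI)
    fix x :: "'p padic"
    show "padic_norm x \<in> insert 0 (range (\<lambda>n. real CARD('p) powi n))"
      by (cases "x = 0") (auto elim: padic_norm_eq_power[of x])
  qed
  then have "countable ?R" by (rule countable_subset) auto
  moreover have "padic_norm -` {c} \<in> sets (borel :: 'p padic measure)" for c
  proof -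
    have "(\<lambda>x. dist x (0 :: 'p padic)) \<in> borel_measurable borel"
      by (intro borel_measurable_continuous_onI continuous_intros)
    then have "padic_norm \<in> borel_measurable (borel :: 'p padic measure)" by (simp add: dist_padic_def)
    from measurable_sets[OF this, of "{c}"] show ?thesis by simp
  qed
  ultimately have "(padic_norm :: 'p padic \<Rightarrow> real) \<in> borel \<rightarrow>\<^sub>M count_space ?R"
    by (subst measurable_count_space_eq_countable) auto
  then show ?thesis by (rule measurable_compose) simp
qed

lemma borel_measurable_fractional_cesaro:
  fixes \<mu> :: "'p::prime_card padic measure"
  assumes \<mu>: "normalized_haar_measure \<mu>"
  shows "fractional_cesaro \<mu> \<beta> f \<in> borel_measurable (completion \<mu>)"
proof -
  have sets: "sets \<mu> = sets borel"
    by (rule normalized_haar_measure_sets[OF \<mu>])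
  have "fractional_cesaro \<mu> \<beta> f \<in> borel_measurable borel"
    unfolding fractional_cesaro_def[abs_def]
    by (rule borel_measurable_comp_padic_norm[of "\<lambda>\<rho>. 1 / \<rho> powr (1 - \<beta>) * (LINT t:{t. padic_norm t \<le> \<rho>}|completion \<mu>. norm (f t))"])
  then have "fractional_cesaro \<mu> \<beta> f \<in> borel_measurable \<mu>"
    using measurable_cong_sets[OF sets refl] by blast
  then show ?thesis by (rule measurable_completion)
qed

lemma ennreal_power_cmult:
  assumes "c > 0"
  shows "ennreal_power (ennreal c * X) s = ennreal (c powr s) * ennreal_power X s"
proof (cases "X = \<infinity>")
  case True
  with assms show ?thesis by (simp add: ennreal_power_def ennreal_mult_eq_top_iff ennreal_mult_top)
next
  case False
  then have "ennreal c * X \<noteq> \<infinity>" by (simp add: ennreal_mult_eq_top_iff)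
  with False assms show ?thesis
    by (simp add: ennreal_power_def enn2real_mult powr_mult ennreal_mult')
qed

text \<open>The contribution of a single ball to the norm; dilation acts on these contributions by permuting the
  balls and rescaling.\<close>

definition cesaro_morrey_local ::
    "'p::prime_card padic measure \<Rightarrow> real \<Rightarrow> real \<Rightarrow> real \<Rightarrow> ('p padic \<Rightarrow> complex) \<Rightarrow> 'p padic \<Rightarrow> int \<Rightarrow> ennreal" where
  "cesaro_morrey_local \<mu> \<beta> r q f a l =
     ennreal (measure \<mu> (padic_ball a l) powr (1 / q - 1 / r)) *
     ennreal_power
       (\<integral>\<^sup>+x\<in>padic_ball a l. ennreal (fractional_cesaro \<mu> \<beta> f x powr r) \<partial>completion \<mu>)
       (1 / r)"

lemma cesaro_morrey_norm_eq_SUP_local: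
  "cesaro_morrey_norm \<mu> \<beta> r q f = (SUP a. SUP l. cesaro_morrey_local \<mu> \<beta> r q f a l)"
  by (simp add: cesaro_morrey_norm_def cesaro_morrey_local_def)

text \<open>The dilated ball \<open>\<xi> B\<close> has centre \<open>\<xi> a\<close> and radius \<open>p\<^bsup>l+v\<^esup>\<close>. Its volume is \<open>\<bar>\<xi>\<bar>\<close> times that of the
  original ball \<open>B\<close>; the powers of \<open>\<bar>\<xi>\<bar>\<close> that arise from this volume, from the substitution and from the Cesaro
  average have the exponents \<open>1/r - 1/q\<close>, \<open>- 1/r\<close> and \<open>- \<beta>\<close>.\<close>

lemma cesaro_morrey_local_dilation:
  fixes \<mu> :: "'p::prime_card padic measure"
  assumes \<mu>: "normalized_haar_measure \<mu>" and "\<xi> \<noteq> 0" and "r > 0"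
    and v: "padic_norm \<xi> = real CARD('p) powi v"
  shows "cesaro_morrey_local \<mu> \<beta> r q (dilation \<xi> f) a l =
    ennreal (padic_norm \<xi> powr (- \<beta> - 1 / q)) * cesaro_morrey_local \<mu> \<beta> r q f (\<xi> * a) (l + v)"
proof -
  let ?n = "padic_norm \<xi>" and ?p = "real CARD('p)"
  \<comment> \<open>The factor by which the integral over the ball changes: \<open>\<bar>\<xi>\<bar>\<^bsup>- \<beta>r\<^esup>\<close> from the \<open>r\<close>-th power of the Cesaro
    average and \<open>\<bar>\<xi>\<bar>\<^bsup>- 1\<^esup>\<close> from the substitution.\<close>
  define c where "c = ?n powr (- \<beta> * r) * inverse ?n"
  define J where "J = (\<integral>\<^sup>+x\<in>padic_ball (\<xi> * a) (l + v). ennreal (fractional_cesaro \<mu> \<beta> f x powr r) \<partial>completion \<mu>)"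
  have n: "?n > 0" by (rule padic_norm_pos[OF assms(2)])
  have c: "c > 0" using n by (simp add: c_def)
  have p1: "?p > 1" by (rule CARD_gt_1)
  have sets: "sets \<mu> = sets borel"
    by (rule normalized_haar_measure_sets[OF \<mu>])
  have B: "padic_ball b k \<in> sets (completion \<mu>)" for b k
    using borel_padic_ball by (auto simp: sets)
  note [measurable] = borel_measurable_fractional_cesaro[OF \<mu>, of \<beta> f] B measurable_completion_dilation[OF assms(1,2)]
  have meas: "measure \<mu> (padic_ball b k) = ?p powi k" for b k
    using normalized_haar_measure_ball[OF \<mu>] p1 by (simp add: measure_def)
  have "(\<integral>\<^sup>+x\<in>padic_ball a l. ennreal (fractional_cesaro \<mu> \<beta> (dilation \<xi> f) x powr r) \<partial>completion \<mu>) =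
    (\<integral>\<^sup>+x. ennreal (?n powr (- \<beta> * r)) * (ennreal (fractional_cesaro \<mu> \<beta> f (\<xi> * x) powr r) *
      indicator (padic_ball (\<xi> * a) (l + v)) (\<xi> * x)) \<partial>completion \<mu>)"
    using padic_mult_mem_ball_iff[OF v assms(2)]
    by (intro nn_integral_cong)
       (auto simp: fractional_cesaro_dilation[OF assms(1,2)] fractional_cesaro_nonneg powr_mult powr_powr
          ennreal_mult' indicator_def)
  also have "\<dots> = ennreal (?n powr (- \<beta> * r)) *
    (\<integral>\<^sup>+x. ennreal (fractional_cesaro \<mu> \<beta> f (\<xi> * x) powr r) *
      indicator (padic_ball (\<xi> * a) (l + v)) (\<xi> * x) \<partial>completion \<mu>)"
    by (rule nn_integral_cmult) measurable
  also have "\<dots> = ennreal c * J"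
    unfolding J_def c_def using n
    by (subst nn_integral_dilation[OF assms(1,2), where g="\<lambda>x. ennreal (fractional_cesaro \<mu> \<beta> f x powr r) *
      indicator (padic_ball (\<xi> * a) (l + v)) x"]) (auto simp: ennreal_mult' mult.assoc)
  finally have "cesaro_morrey_local \<mu> \<beta> r q (dilation \<xi> f) a l =
      ennreal ((?p powi l) powr (1 / q - 1 / r)) * (ennreal (c powr (1 / r)) * ennreal_power J (1 / r))"
    unfolding cesaro_morrey_local_def by (simp add: meas ennreal_power_cmult[OF c])
  also have "\<dots> = ennreal ((?p powi l) powr (1 / q - 1 / r) * c powr (1 / r)) * ennreal_power J (1 / r)"
    by (simp add: ennreal_mult' mult.assoc)
  also have "(?p powi l) powr (1 / q - 1 / r) * c powr (1 / r) =
      ?n powr (- \<beta> - 1 / q) * (?p powi (l + v)) powr (1 / q - 1 / r)"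
  proof -
    have "c = ?n powr (- \<beta> * r - 1)"
      using n by (simp add: c_def powr_diff field_simps)
    then have "c powr (1 / r) = ?n powr (- \<beta> - 1 / r)"
      using assms(3) by (simp add: powr_powr field_simps)
    moreover have "(?p powi (l + v)) powr (1 / q - 1 / r) = (?p powi l) powr (1 / q - 1 / r) * ?n powr (1 / q - 1 / r)"
      using p1 by (simp add: power_int_add v powr_mult)
    moreover have "?n powr (- \<beta> - 1 / r) = ?n powr (- \<beta> - 1 / q) * ?n powr (1 / q - 1 / r)"
      by (simp flip: powr_add)
    ultimately show ?thesis by simp
  qed
  finally show ?thesis
    unfolding cesaro_morrey_local_def J_def by (simp add: meas ennreal_mult' mult.assoc)
qed

lemma SUP_reindex_surj: "surj g \<Longrightarrow> (SUP x. H (g x)) = (SUP x. H x)"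
  by (metis image_image)

lemma cesaro_morrey_norm_dilation:
  fixes \<mu> :: "'p::prime_card padic measure"
  assumes \<mu>: "normalized_haar_measure \<mu>" and "\<xi> \<noteq> 0" and "r > 0"
  shows "cesaro_morrey_norm \<mu> \<beta> r q (dilation \<xi> f) =
    ennreal (padic_norm \<xi> powr (- \<beta> - 1 / q)) * cesaro_morrey_norm \<mu> \<beta> r q f"
proof -
  obtain v where v: "padic_norm \<xi> = real CARD('p) powi v"
    using padic_norm_eq_power[OF assms(2)] by blast
  have 1: "surj (\<lambda>a. \<xi> * a)"
    by (rule surjI[of _ "\<lambda>a. a / \<xi>"]) (use assms(2) in simp)
  have 2: "surj (\<lambda>l. l + v)"
    by (rule surjI[of _ "\<lambda>l. l - v"]) simp
  show ?thesis
    by (simp add: cesaro_morrey_norm_eq_SUP_local cesaro_morrey_local_dilation[OF assms v]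
        SUP_reindex_surj[OF 1, where H="\<lambda>a. SUP l. cesaro_morrey_local \<mu> \<beta> r q f a l"]
        SUP_reindex_surj[OF 2, where H="cesaro_morrey_local \<mu> \<beta> r q f _"]
        flip: SUP_mult_left_ennreal)
qed

theorem lemma12:
  fixes \<mu> :: "'p::prime_card padic measure"
    and \<xi> :: "'p padic"
    and r q \<beta> :: real
  assumes "normalized_haar_measure \<mu>"
    and "1 \<le> r" and "r \<le> q"
    and "0 \<le> \<beta>" and "\<beta> < 1"
    and "\<xi> \<noteq> 0"
  shows "bounded_on_cesaro_morrey \<mu> \<beta> r q (dilation \<xi>) \<and>
    (\<forall>f\<in>cesaro_morrey_space \<mu> \<beta> r q.
       cesaro_morrey_norm \<mu> \<beta> r q (dilation \<xi> f) =
         ennreal (padic_norm \<xi> powr (- \<beta> - 1 / q)) * cesaro_morrey_norm \<mu> \<beta> r q f)"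
proof -
  let ?C = "padic_norm \<xi> powr (- \<beta> - 1 / q)"
  have norm: "cesaro_morrey_norm \<mu> \<beta> r q (dilation \<xi> f) = ennreal ?C * cesaro_morrey_norm \<mu> \<beta> r q f" for f
    using assms(1,2,6) by (intro cesaro_morrey_norm_dilation) auto
  have "dilation \<xi> f \<in> cesaro_morrey_space \<mu> \<beta> r q" if "f \<in> cesaro_morrey_space \<mu> \<beta> r q" for f
    using that locally_integrable_dilation[OF assms(1,6)]
    by (auto simp: cesaro_morrey_space_def norm ennreal_mult_less_top)
  moreover have "\<exists>C\<ge>0. \<forall>f\<in>cesaro_morrey_space \<mu> \<beta> r q.
      cesaro_morrey_norm \<mu> \<beta> r q (dilation \<xi> f) \<le> ennreal C * cesaro_morrey_norm \<mu> \<beta> r q f"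
    by (intro exI[of _ ?C]) (simp add: norm)
  ultimately show ?thesis
    by (simp add: bounded_on_cesaro_morrey_def norm)
qed

end
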